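(* Let $1\le d\le n$. For any $d$-graph $H$ with vertex set $V(H)=[n]=\{1,\dots,n\}$, the complex $X_{d,n}[H]$ is isomorphic as a cell complex to $X_H$. In particular, the complex $X_H$ can be realized as a subcomplex of a mixed subdivision of the dilated simplex $d\Delta_{n-d}$.
   Context: A $d$-graph $H$ on $[n]$ is a set $E(H)$ of $d$-element subsets of $[n]$, called edges. The complex $X_H$: let $V=[n]$ and let $\Delta_V$ be the simplex with vertex set $V$. For $\sigma,\tau\subseteq V$ write $\sigma<\tau$ if $s<t$ for all $s\in\sigma,t\in\tau$. $X_H$ is the subcomplex of the $d$-fold product $\Delta_V\times\cdots\times\Delta_V$ consisting of all cells $\sigma_1\times\cdots\times\sigma_d$ with $\emptyset\neq\sigma_i\subseteq V$, $\sigma_1<\cdots<\sigma_d$, and such that $\{v_1,\dots,v_d\}\in E(H)$ whenever $v_i\in\sigma_i$ for all $i$. Mixed subdivisions: put $m=n-d$, let $e_1,\dots,e_{m+1}$ be the standard basis of $\mathbb{R}^{m+1}$ and $\Delta_m=\mathrm{conv}\{e_1,\dots,e_{m+1}\}$. $d\Delta_m$ is the $d$-fold Minkowski sum $\Delta_m+\cdots+\Delta_m$. A fine mixed cell of $d\Delta_m$ is a Minkowski sum $B_1+\cdots+B_d$, where the $B_i$ are faces of $\Delta_m$ lying in independent affine subspaces and with dimensions adding up to $m$. A (fine) mixed subdivision of $d\Delta_m$ is a polyhedral subdivision of $d\Delta_m$ whose maximal cells are (fine) mixed cells, where a mixed cell in general is an $m$-dimensional Minkowski sum of $d$ faces of $\Delta_m$.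 The complex $X_{d,n}$: for each sequence $1=b_1\le b_2\le\cdots\le b_d\le b_{d+1}=m+1$ of integers, let $B_i=\mathrm{conv}\{e_{b_i},e_{b_i+1},\dots,e_{b_{i+1}}\}$ for $1\le i\le d$, and associate to the sequence the fine mixed cell $B_1+\cdots+B_d$. The collection of these cells is a fine mixed subdivision of $d\Delta_m$ (it corresponds under the Cayley trick to the staircase triangulation of $\Delta_{d-1}\times\Delta_m$); $X_{d,n}$ denotes this polyhedral complex (all the cells and their faces). Its vertices are the points $e_{i_1}+\cdots+e_{i_d}$ with $1\le i_1\le\cdots\le i_d\le m+1$. The vertex $e_{i_1}+\cdots+e_{i_d}$ is labeled by the $d$-subset $\{i_1,i_2+1,\dots,i_d+d-1\}$ of $[n]$; this is a bijection between vertices of $X_{d,n}$ and $d$-subsets of $[n]$. For a $d$-graph $H$ on $[n]$, $X_{d,n}[H]$ is the subcomplex of $X_{d,n}$ induced by the vertices whose labels are edges of $H$, i.e. the subcomplex of all cells all of whose vertices are labeled by edges of $H$. *)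

theory Defs
  imports "HOL-Analysis.Analysis"
begin

text \<open>Cells of all complexes below are nonempty closed sets; the empty face is not a cell.\<close>

definition d_graph :: "nat \<Rightarrow> nat \<Rightarrow> nat set set \<Rightarrow> bool" where
  "d_graph n d E \<longleftrightarrow> (\<forall>A\<in>E. A \<subseteq> {1..n} \<and> card A = d)"

text \<open>
  An isomorphism of cell complexes is a homeomorphism of the underlying spaces that maps the
  cells of one complex bijectively onto the cells of the other one (so, in particular, it
  induces an isomorphism of the face posets).
\<close>

definition cell_complex_isomorphic ::
  "'a::topological_space set set \<Rightarrow> 'b::topological_space set set \<Rightarrow> bool" where
  "cell_complex_isomorphic K L \<longleftrightarrow>
    (\<exists>f g. homeomorphism (\<Union>K) (\<Union>L) f g \<and> bij_betw (\<lambda>C. f ` C) K L)"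


subsection \<open>The complex of a hypergraph\<close>

text \<open>
  The simplex on a vertex set \<open>V\<close> is realized by barycentric coordinates, that is, by
  functions \<open>nat \<Rightarrow> real\<close> supported on \<open>V\<close>; the face spanned by \<open>\<sigma> \<subseteq> V\<close> is \<open>simplex_on \<sigma>\<close>.
  Products are indexed by \<open>{1..d}\<close>, and carry the product topology, which is the one that the
  library puts on function types.
\<close>

definition simplex_on :: "nat set \<Rightarrow> (nat \<Rightarrow> real) set" where
  "simplex_on \<sigma> = {t. (\<forall>v\<in>\<sigma>. 0 \<le> t v) \<and> (\<forall>v. v \<notin> \<sigma> \<longrightarrow> t v = 0) \<and> (\<Sum>v\<in>\<sigma>. t v) = 1}"

definition product_cell :: "nat \<Rightarrow> (nat \<Rightarrow> nat set) \<Rightarrow> (nat \<Rightarrow> nat \<Rightarrow> real) set" where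
  "product_cell d \<sigma> = (\<Pi>\<^sub>E i\<in>{1..d}. simplex_on (\<sigma> i))"

definition set_less :: "nat set \<Rightarrow> nat set \<Rightarrow> bool" where
  "set_less \<sigma> \<tau> \<longleftrightarrow> (\<forall>s\<in>\<sigma>. \<forall>t\<in>\<tau>. s < t)"

definition X_graph :: "nat \<Rightarrow> nat \<Rightarrow> nat set set \<Rightarrow> (nat \<Rightarrow> nat \<Rightarrow> real) set set" where
  "X_graph n d E =
    {product_cell d \<sigma> | \<sigma>.
      (\<forall>i\<in>{1..d}. \<sigma> i \<noteq> {} \<and> \<sigma> i \<subseteq> {1..n}) \<and>
      (\<forall>i\<in>{1..d}. \<forall>j\<in>{1..d}. i < j \<longrightarrow> set_less (\<sigma> i) (\<sigma> j)) \<and>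
      (\<forall>v. (\<forall>i\<in>{1..d}. v i \<in> \<sigma> i) \<longrightarrow> v ` {1..d} \<in> E)}"


subsection \<open>Polyhedral complexes and mixed subdivisions\<close>

definition polyhedral_complex :: "'a::euclidean_space set set \<Rightarrow> bool" where
  "polyhedral_complex K \<longleftrightarrow>
    finite K \<and>
    (\<forall>C\<in>K. polytope C \<and> C \<noteq> {}) \<and>
    (\<forall>C\<in>K. \<forall>F. F face_of C \<and> F \<noteq> {} \<longrightarrow> F \<in> K) \<and>
    (\<forall>C\<in>K. \<forall>D\<in>K. (C \<inter> D) face_of C \<and> (C \<inter> D) face_of D)"

definition polyhedral_subdivision :: "'a::euclidean_space set set \<Rightarrow> 'a set \<Rightarrow> bool" where
  "polyhedral_subdivision K P \<longleftrightarrow> polyhedral_complex K \<and> \<Union>K = P"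

definition subcomplex :: "'a::euclidean_space set set \<Rightarrow> 'a set set \<Rightarrow> bool" where
  "subcomplex L K \<longleftrightarrow> L \<subseteq> K \<and> (\<forall>C\<in>L. \<forall>F. F face_of C \<and> F \<noteq> {} \<longrightarrow> F \<in> L)"

definition maximal_cell :: "'a set set \<Rightarrow> 'a set \<Rightarrow> bool" where
  "maximal_cell K C \<longleftrightarrow> C \<in> K \<and> (\<forall>D\<in>K. C \<subseteq> D \<longrightarrow> D = C)"

text \<open>
  The space \<open>\<real>\<^bsup>m+1\<^esup>\<close> is a Euclidean space whose standard basis \<open>Basis\<close> is enumerated
  as \<open>e 1, \<dots>, e (m + 1)\<close>. Sums of sets are Minkowski sums.
\<close>

definition std_simplex :: "(nat \<Rightarrow> 'a::euclidean_space) \<Rightarrow> nat \<Rightarrow> 'a set" where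
  "std_simplex e m = convex hull (e ` {1..m+1})"

definition dilated_simplex :: "(nat \<Rightarrow> 'a::euclidean_space) \<Rightarrow> nat \<Rightarrow> nat \<Rightarrow> 'a set" where
  "dilated_simplex e d m = (\<Sum>i\<in>{1..d}. std_simplex e m)"

definition mixed_cell :: "(nat \<Rightarrow> 'a::euclidean_space) \<Rightarrow> nat \<Rightarrow> nat \<Rightarrow> 'a set \<Rightarrow> bool" where
  "mixed_cell e d m C \<longleftrightarrow>
    (\<exists>B. (\<forall>i\<in>{1..d}. B i face_of std_simplex e m) \<and> C = (\<Sum>i\<in>{1..d}. B i)) \<and>
    aff_dim C = int m"

definition mixed_subdivision :: "(nat \<Rightarrow> 'a::euclidean_space) \<Rightarrow> nat \<Rightarrow> nat \<Rightarrow> 'a set set \<Rightarrow> bool" where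
  "mixed_subdivision e d m S \<longleftrightarrow>
    polyhedral_subdivision S (dilated_simplex e d m) \<and>
    (\<forall>C. maximal_cell S C \<longrightarrow> mixed_cell e d m C)"


subsection \<open>The staircase subdivision and its induced subcomplexes\<close>

definition staircase_cell :: "(nat \<Rightarrow> 'a::euclidean_space) \<Rightarrow> nat \<Rightarrow> (nat \<Rightarrow> nat) \<Rightarrow> 'a set" where
  "staircase_cell e d b = (\<Sum>i\<in>{1..d}. convex hull (e ` {b i..b (i + 1)}))"

definition X_staircase :: "(nat \<Rightarrow> 'a::euclidean_space) \<Rightarrow> nat \<Rightarrow> nat \<Rightarrow> 'a set set" where
  "X_staircase e d n =
    {F. F \<noteq> {} \<and>
      (\<exists>b. b 1 = 1 \<and> b (d + 1) = (n - d) + 1 \<and> (\<forall>i\<in>{1..d}. b i \<le> b (i + 1)) \<and>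
           F face_of staircase_cell e d b)}"

text \<open>
  The label of the point \<open>e i\<^sub>1 + \<dots> + e i\<^sub>d\<close> with \<open>1 \<le> i\<^sub>1 \<le> \<dots> \<le> i\<^sub>d \<le> n - d + 1\<close>. It is
  well defined on such points, since the \<open>e i\<close> are linearly independent, and unspecified on
  all other points.
\<close>

definition vertex_label :: "(nat \<Rightarrow> 'a::euclidean_space) \<Rightarrow> nat \<Rightarrow> nat \<Rightarrow> 'a \<Rightarrow> nat set" where
  "vertex_label e d n x =
    (THE L. \<exists>i. i \<in> {1..d} \<rightarrow> {1..(n - d) + 1} \<and> mono_on {1..d} i \<and>
                x = (\<Sum>k\<in>{1..d}. e (i k)) \<and> L = (\<lambda>k. i k + (k - 1)) ` {1..d})"

definition X_induced ::
  "(nat \<Rightarrow> 'a::euclidean_space) \<Rightarrow> nat \<Rightarrow> nat \<Rightarrow> nat set set \<Rightarrow> 'a set set" where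
  "X_induced e d n E =
    {C \<in> X_staircase e d n. \<forall>x. x extreme_point_of C \<longrightarrow> vertex_label e d n x \<in> E}"

end

theory Submission
  imports Defs
begin

text \<open>
  Weakly increasing families \<open>\<tau> 1 \<le> \<dots> \<le> \<tau> d\<close> of subsets of \<open>{1..n - d + 1}\<close> index the cells of
  both complexes: \<open>\<tau>\<close> stands for the Minkowski sum of the simplices \<open>conv (e ` \<tau> i)\<close> on one side, and,
  after shifting \<open>\<tau> i\<close> by \<open>i - 1\<close>, for a product cell of the complex of the hypergraph on the other
  side. Addition maps the product of the simplices \<open>conv (e ` \<tau> i)\<close> onto their Minkowski sum, and the
  inverse is given by one formula on all of the dilated simplex, which yields the homeomorphism and
  the subdivision property at once: cut the interval \<open>[0, d]\<close> into consecutive pieces whose lengths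
  are the coordinates of \<open>x\<close>; then the \<open>j\<close>th barycentric coordinate of the \<open>i\<close>th summand of \<open>x\<close> is
  the length of the part of the \<open>j\<close>th piece inside \<open>[i - 1, i]\<close>. A point lies in the cell of
  \<open>\<tau>\<close> iff the supports of its summands are contained in the \<open>\<tau> i\<close>, so intersections and faces of cells
  are read off from the families.
\<close>

section \<open>Truncation to the unit interval, and simplices in barycentric coordinates\<close>

definition clamp01 :: "real \<Rightarrow> real" where
  "clamp01 s = max 0 (min 1 s)"

lemma clamp01_mono: "s \<le> t \<Longrightarrow> clamp01 s \<le> clamp01 t"
  by (auto simp: clamp01_def)

text \<open>The i-th term is the length of the part of [0, s] inside [i - 1, i], so the sum measures
  the part of [0, s] inside [0, d].\<close>

lemma sum_clamp01:
  assumes "0 \<le> s"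
  shows "(\<Sum>i\<in>{1..d}. clamp01 (s - (real i - 1))) = min s (real d)"
  using assms by (induction d) (auto simp: clamp01_def min_def max_def)

lemma simplex_on_nonneg: "t \<in> simplex_on A \<Longrightarrow> 0 \<le> t v"
  by (cases "v \<in> A") (auto simp: simplex_on_def)

lemma simplex_on_outside: "t \<in> simplex_on A \<Longrightarrow> v \<notin> A \<Longrightarrow> t v = 0"
  by (auto simp: simplex_on_def)

lemma simplex_on_sum:
  assumes "t \<in> simplex_on A" "finite B" "A \<subseteq> B"
  shows "sum t B = 1"
proof -
  have "sum t B = sum t A"
    using assms by (intro sum.mono_neutral_right) (auto simp: simplex_on_def)
  then show ?thesis
    using assms by (simp add: simplex_on_def)
qed

lemma simplex_onI:
  assumes "finite B" "A \<subseteq> B" "\<And>v. 0 \<le> t v" "\<And>v. v \<notin> A \<Longrightarrow> t v = 0" "sum t B = 1"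
  shows "t \<in> simplex_on A"
proof -
  have "sum t B = sum t A"
    using assms by (intro sum.mono_neutral_right) auto
  then show ?thesis
    using assms by (simp add: simplex_on_def)
qed

lemma simplex_on_mono:
  assumes "t \<in> simplex_on A" "A \<subseteq> B" "finite B"
  shows "t \<in> simplex_on B"
  using assms by (intro simplex_onI[of B]) (auto simp: simplex_on_nonneg simplex_on_sum
      intro: simplex_on_outside)

lemma simplex_on_le_1:
  assumes "t \<in> simplex_on A" "finite A"
  shows "t v \<le> 1"
proof (cases "v \<in> A")
  case True
  then have "t v \<le> sum t A"
    using assms by (intro member_le_sum) (auto simp: simplex_on_def)
  then show ?thesis
    using assms by (simp add: simplex_on_def)
next
  case False
  then show ?thesis
    using simplex_on_outside[OF assms(1)] by simp
qed

lemma simplex_on_ne: "t \<in> simplex_on A \<Longrightarrow> A \<noteq> {}"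
  by (auto simp: simplex_on_def)

lemma simplex_on_convex:
  assumes "s \<in> simplex_on A" "t \<in> simplex_on A" "0 \<le> u" "u \<le> (1::real)"
  shows "(\<lambda>v. (1 - u) * s v + u * t v) \<in> simplex_on A"
  using assms by (auto simp: simplex_on_def sum.distrib sum_distrib_left[symmetric])

text \<open>Truncated subtraction sends every v < k to 0, where \<open>t\<close> vanishes because 0
  lies outside \<open>A\<close>; so no mass appears below k.\<close>

lemma simplex_on_shift:
  assumes "t \<in> simplex_on A" "0 \<notin> A"
  shows "(\<lambda>v. t (v - k)) \<in> simplex_on ((\<lambda>j. j + k) ` A)"
proof -
  have "t (v - k) = 0" if "v \<notin> (\<lambda>j. j + k) ` A" for v
  proof (cases "v \<ge> k")
    case True
    then have "v - k \<notin> A"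
      using that by (metis image_eqI le_add_diff_inverse2)
    then show ?thesis
      using assms simplex_on_outside by blast
  next
    case False
    then show ?thesis
      using assms simplex_on_outside by (metis diff_is_0_eq' nat_le_linear)
  qed
  moreover have "sum (\<lambda>v. t (v - k)) ((\<lambda>j. j + k) ` A) = sum t A"
    by (subst sum.reindex) (auto simp: inj_on_def)
  ultimately show ?thesis
    using assms by (auto simp: simplex_on_def)
qed

lemma simplex_on_unshift:
  assumes "t \<in> simplex_on ((\<lambda>j. j + k) ` A)"
  shows "(\<lambda>v. t (v + k)) \<in> simplex_on A"
proof -
  have "sum t ((\<lambda>j. j + k) ` A) = sum (\<lambda>v. t (v + k)) A"
    by (subst sum.reindex) (auto simp: inj_on_def)
  moreover have "t (v + k) = 0" if "v \<notin> A" for v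
    using that assms by (intro simplex_on_outside[OF assms]) auto
  ultimately show ?thesis
    using assms by (auto simp: simplex_on_def)
qed

subsection \<open>Cells of increasing families\<close>

locale staircase =
  fixes e :: "nat \<Rightarrow> 'a::euclidean_space" and N d :: nat
  assumes bij_e: "bij_betw e {1..N} (Basis :: 'a set)"
    and d_pos: "1 \<le> d"
begin

text \<open>The cut points between consecutive pieces of [0, d]. Capping with \<open>min j N\<close>
  keeps them constant from \<open>N\<close> on, so that \<open>e\<close> is evaluated on
  \<open>{1..N}\<close> only and later pieces have length 0.\<close>

definition psum :: "'a \<Rightarrow> nat \<Rightarrow> real" where
  "psum x j = (\<Sum>k\<in>{1..min j N}. x \<bullet> e k)"

text \<open>The length of the overlap of \<open>[psum x (j - 1), psum x j]\<close> with \<open>[i - 1, i]\<close>.\<close>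

definition overlap :: "'a \<Rightarrow> nat \<Rightarrow> nat \<Rightarrow> real" where
  "overlap x i j = clamp01 (psum x j - (real i - 1)) - clamp01 (psum x (j - 1) - (real i - 1))"

definition blend :: "(nat \<Rightarrow> nat \<Rightarrow> real) \<Rightarrow> 'a" where
  "blend t = (\<Sum>i\<in>{1..d}. \<Sum>j\<in>{1..N}. t i j *\<^sub>R e j)"

definition supp :: "'a \<Rightarrow> nat \<Rightarrow> nat set" where
  "supp x i = {j. overlap x i j \<noteq> 0}"

text \<open>The dilated simplex in coordinates; \<open>dilated_simplex_eq\<close> identifies it with
  the Minkowski sum.\<close>

definition dilate :: "'a set" where
  "dilate = {x. (\<forall>k\<in>{1..N}. 0 \<le> x \<bullet> e k) \<and> (\<Sum>k\<in>{1..N}. x \<bullet> e k) = real d}"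

definition stairs :: "(nat \<Rightarrow> nat set) \<Rightarrow> bool" where
  "stairs \<tau> \<longleftrightarrow> (\<forall>i\<in>{1..d}. \<tau> i \<noteq> {} \<and> \<tau> i \<subseteq> {1..N}) \<and>
    (\<forall>i\<in>{1..d}. \<forall>j\<in>{1..d}. i < j \<longrightarrow> (\<forall>s\<in>\<tau> i. \<forall>t\<in>\<tau> j. s \<le> t))"

definition cell :: "(nat \<Rightarrow> nat set) \<Rightarrow> 'a set" where
  "cell \<tau> = (\<Sum>i\<in>{1..d}. convex hull (e ` \<tau> i))"

lemma e_image: "e ` {1..N} = Basis"
  using bij_e by (simp only: bij_betw_def)

lemma inj_e: "inj_on e {1..N}"
  using bij_e by (simp only: bij_betw_def)

lemma inner_e:
  assumes "j \<in> {1..N}" "k \<in> {1..N}"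
  shows "e j \<bullet> e k = (if j = k then 1 else 0)"
proof -
  have "e j \<in> Basis" "e k \<in> Basis"
    using assms e_image by blast+
  moreover have "e j = e k \<longleftrightarrow> j = k"
    using assms inj_e inj_on_eq_iff by fastforce
  ultimately show ?thesis
    by (simp only: inner_Basis)
qed

lemma expand: "(\<Sum>j\<in>{1..N}. (x \<bullet> e j) *\<^sub>R e j) = x"
proof -
  have "(\<Sum>j\<in>{1..N}. (x \<bullet> e j) *\<^sub>R e j) = (\<Sum>b\<in>Basis. (x \<bullet> b) *\<^sub>R b)"
    using bij_e by (rule sum.reindex_bij_betw)
  also have "\<dots> = x"
    by (rule euclidean_representation)
  finally show ?thesis .
qed

lemma inner_blend:
  assumes "k \<in> {1..N}"
  shows "blend t \<bullet> e k = (\<Sum>i\<in>{1..d}. t i k)"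
proof -
  have "(\<Sum>j\<in>{1..N}. t i j * (e j \<bullet> e k)) = (\<Sum>j\<in>{1..N}. if j = k then t i j else 0)" for i
    using assms inner_e by (intro sum.cong) auto
  then show ?thesis
    using assms by (simp add: blend_def inner_sum_left)
qed

lemma blend_cong: "(\<And>i j. i \<in> {1..d} \<Longrightarrow> j \<in> {1..N} \<Longrightarrow> s i j = t i j) \<Longrightarrow> blend s = blend t"
  unfolding blend_def by (intro sum.cong) auto

lemma convex_hull_e:
  assumes "A \<subseteq> {1..N}"
  shows "convex hull (e ` A) = (\<lambda>t. \<Sum>j\<in>{1..N}. t j *\<^sub>R e j) ` simplex_on A"
proof -
  have fin: "finite A"
    using assms finite_subset by blast
  have inj: "inj_on e A"
    using inj_e assms inj_on_subset by blast
  have sm: "(\<Sum>j\<in>{1..N}. t j *\<^sub>R e j) = (\<Sum>j\<in>A. t j *\<^sub>R e j)" if "t \<in> simplex_on A" for t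
    using assms that by (intro sum.mono_neutral_right) (auto simp: simplex_on_def)
  have hull: "convex hull (e ` A) =
      {y. \<exists>u. (\<forall>x\<in>e ` A. 0 \<le> u x) \<and> sum u (e ` A) = 1 \<and> (\<Sum>x\<in>e ` A. u x *\<^sub>R x) = y}"
    using fin by (intro convex_hull_finite finite_imageI)
  show ?thesis
  proof (intro set_eqI iffI)
    fix x assume "x \<in> convex hull (e ` A)"
    then obtain u where u: "\<forall>y\<in>e ` A. 0 \<le> u y" "sum u (e ` A) = 1" "(\<Sum>y\<in>e ` A. u y *\<^sub>R y) = x"
      unfolding hull by blast
    let ?t = "\<lambda>j. if j \<in> A then u (e j) else 0"
    have t: "?t \<in> simplex_on A"
      using u(1,2) by (simp add: simplex_on_def sum.reindex[OF inj])
    have "(\<Sum>j\<in>A. ?t j *\<^sub>R e j) = x"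
      using u(3) by (simp add: sum.reindex[OF inj])
    then show "x \<in> (\<lambda>t. \<Sum>j\<in>{1..N}. t j *\<^sub>R e j) ` simplex_on A"
      using sm[OF t] by (intro image_eqI[OF _ t]) (simp only:)
  next
    fix x assume "x \<in> (\<lambda>t. \<Sum>j\<in>{1..N}. t j *\<^sub>R e j) ` simplex_on A"
    then obtain t where t: "t \<in> simplex_on A" "x = (\<Sum>j\<in>A. t j *\<^sub>R e j)"
      using sm by blast
    let ?u = "\<lambda>y. t (inv_into A e y)"
    have "\<forall>y\<in>e ` A. 0 \<le> ?u y"
      using simplex_on_nonneg[OF t(1)] by blast
    moreover have "sum ?u (e ` A) = sum t A"
      unfolding sum.reindex[OF inj] by (intro sum.cong) (simp_all only: o_def inv_into_f_f[OF inj])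
    moreover have "(\<Sum>y\<in>e ` A. ?u y *\<^sub>R y) = x"
      unfolding sum.reindex[OF inj] t(2)
      by (intro sum.cong) (simp_all only: o_def inv_into_f_f[OF inj])
    moreover have "sum t A = 1"
      using t(1) fin by (intro simplex_on_sum) auto
    ultimately have "(\<forall>y\<in>e ` A. 0 \<le> ?u y) \<and> sum ?u (e ` A) = 1 \<and> (\<Sum>y\<in>e ` A. ?u y *\<^sub>R y) = x"
      by (simp only:)
    then show "x \<in> convex hull (e ` A)"
      unfolding hull by (intro CollectI exI)
  qed
qed

lemma cell_eq:
  assumes "\<And>i. i \<in> {1..d} \<Longrightarrow> \<tau> i \<subseteq> {1..N}"
  shows "cell \<tau> = {blend t |t. \<forall>i\<in>{1..d}. t i \<in> simplex_on (\<tau> i)}"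
proof -
  have "cell \<tau> = {sum s {1..d} |s. \<forall>i\<in>{1..d}. s i \<in> convex hull (e ` \<tau> i)}"
    unfolding cell_def by (rule set_sum_alt) simp
  also have "\<dots> = {blend t |t. \<forall>i\<in>{1..d}. t i \<in> simplex_on (\<tau> i)}"
  proof (intro set_eqI iffI)
    fix x assume "x \<in> {sum s {1..d} |s. \<forall>i\<in>{1..d}. s i \<in> convex hull (e ` \<tau> i)}"
    then obtain s where s: "x = sum s {1..d}" "\<forall>i\<in>{1..d}. s i \<in> convex hull (e ` \<tau> i)"
      by blast
    then have "\<forall>i\<in>{1..d}. \<exists>t. t \<in> simplex_on (\<tau> i) \<and> s i = (\<Sum>j\<in>{1..N}. t j *\<^sub>R e j)"
      using convex_hull_e assms by blast
    then obtain t where "\<forall>i\<in>{1..d}. t i \<in> simplex_on (\<tau> i) \<and> s i = (\<Sum>j\<in>{1..N}. t i j *\<^sub>R e j)"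
      by metis
    moreover from this have "x = blend t"
      unfolding s blend_def by (intro sum.cong) auto
    ultimately show "x \<in> {blend t |t. \<forall>i\<in>{1..d}. t i \<in> simplex_on (\<tau> i)}"
      by blast
  next
    fix x assume "x \<in> {blend t |t. \<forall>i\<in>{1..d}. t i \<in> simplex_on (\<tau> i)}"
    then obtain t where t: "x = blend t" "\<forall>i\<in>{1..d}. t i \<in> simplex_on (\<tau> i)"
      by blast
    then have "\<forall>i\<in>{1..d}. (\<Sum>j\<in>{1..N}. t i j *\<^sub>R e j) \<in> convex hull (e ` \<tau> i)"
      using convex_hull_e assms by blast
    then show "x \<in> {sum s {1..d} |s. \<forall>i\<in>{1..d}. s i \<in> convex hull (e ` \<tau> i)}"
      unfolding t(1) blend_def by blast
  qed
  finally show ?thesis .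
qed

lemma stairs_sub: "stairs \<tau> \<Longrightarrow> i \<in> {1..d} \<Longrightarrow> \<tau> i \<subseteq> {1..N}"
  unfolding stairs_def by blast

lemma stairs_le: "stairs \<tau> \<Longrightarrow> i \<in> {1..d} \<Longrightarrow> j \<in> {1..d} \<Longrightarrow> i < j \<Longrightarrow> s \<in> \<tau> i \<Longrightarrow> t \<in> \<tau> j \<Longrightarrow> s \<le> t"
  unfolding stairs_def by blast

lemma stairs_subfamily:
  assumes "stairs \<tau>" "\<And>i. i \<in> {1..d} \<Longrightarrow> \<tau>' i \<subseteq> \<tau> i" "\<And>i. i \<in> {1..d} \<Longrightarrow> \<tau>' i \<noteq> {}"
  shows "stairs \<tau>'"
proof -
  have "\<tau>' i \<subseteq> {1..N}" if "i \<in> {1..d}" for i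
    using stairs_sub[OF assms(1) that] assms(2)[OF that] by blast
  moreover have "s \<le> t" if "i \<in> {1..d}" "j \<in> {1..d}" "i < j" "s \<in> \<tau>' i" "t \<in> \<tau>' j" for i j s t
    using stairs_le[OF assms(1) that(1-3)] assms(2) that by blast
  ultimately show ?thesis
    using assms(3) unfolding stairs_def by blast
qed

text \<open>Since the sets of the family are ordered, positive mass of one factor on
  \<open>{1..j}\<close> forces full mass of all earlier factors there, and mass below 1 forces mass
  0 of all later ones. Thus the total mass fills the unit intervals one after the other, and
  clamping reads off the share of factor \<open>i\<close>.\<close>

lemma clamp_psum_blend:
  assumes "stairs \<tau>" "\<forall>i\<in>{1..d}. t i \<in> simplex_on (\<tau> i)" "i \<in> {1..d}"
  shows "clamp01 (psum (blend t) j - (real i - 1)) = (\<Sum>k\<in>{1..j}. t i k)"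
proof -
  define T where "T i = (\<Sum>k\<in>{1..j}. t i k)" for i
  have sx: "t i' \<in> simplex_on (\<tau> i')" "\<tau> i' \<subseteq> {1..N}" if "i' \<in> {1..d}" for i'
    using assms(2) stairs_sub[OF assms(1)] that by auto
  have T0: "0 \<le> T i'" if "i' \<in> {1..d}" for i'
    unfolding T_def using simplex_on_nonneg[OF sx(1)[OF that]] by (intro sum_nonneg) auto
  have T1: "T i' \<le> 1" if "i' \<in> {1..d}" for i'
  proof -
    have "T i' \<le> (\<Sum>k\<in>{1..max j N}. t i' k)"
      unfolding T_def using simplex_on_nonneg[OF sx(1)[OF that]] by (intro sum_mono2) auto
    also have "\<dots> = 1"
    proof (rule simplex_on_sum[OF sx(1)[OF that]])
      show "\<tau> i' \<subseteq> {1..max j N}"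
        using sx(2)[OF that] by (rule subset_trans) simp
    qed simp
    finally show ?thesis .
  qed
  have Tfull: "T i' = 1" if "i' \<in> {1..d}" "\<tau> i' \<subseteq> {..j}" for i'
    unfolding T_def
  proof (rule simplex_on_sum[OF sx(1)[OF that(1)]])
    show "\<tau> i' \<subseteq> {1..j}"
      using sx(2)[OF that(1)] that(2) by (meson atLeastAtMost_iff atMost_iff subset_iff)
  qed simp
  have Tempty: "T i' = 0" if "i' \<in> {1..d}" "\<tau> i' \<inter> {..j} = {}" for i'
    unfolding T_def
  proof (intro sum.neutral ballI)
    fix k assume "k \<in> {1..j}"
    then have "k \<notin> \<tau> i'"
      using that(2) by auto
    then show "t i' k = 0"
      by (rule simplex_on_outside[OF sx(1)[OF that(1)]])
  qed
  have "psum (blend t) j = (\<Sum>k\<in>{1..min j N}. \<Sum>i\<in>{1..d}. t i k)"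
    unfolding psum_def by (intro sum.cong refl inner_blend) simp
  also have "\<dots> = (\<Sum>i\<in>{1..d}. \<Sum>k\<in>{1..min j N}. t i k)"
    by (rule sum.swap)
  also have "\<dots> = sum T {1..d}"
    unfolding T_def
  proof (rule sum.cong[OF refl], rule sum.mono_neutral_left)
    fix i' assume i': "i' \<in> {1..d}"
    show "\<forall>k\<in>{1..j} - {1..min j N}. t i' k = 0"
    proof
      fix k assume "k \<in> {1..j} - {1..min j N}"
      then have "k \<notin> {1..N}" by auto
      then show "t i' k = 0"
        using sx(2)[OF i'] by (intro simplex_on_outside[OF sx(1)[OF i']]) blast
    qed
  qed auto
  also have "{1..d} = {1..<i} \<union> {i} \<union> {i<..d}"
    using assms(3) by auto
  also have "sum T ({1..<i} \<union> {i} \<union> {i<..d}) = sum T {1..<i} + T i + sum T {i<..d}"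
    by (subst sum.union_disjoint; (subst sum.union_disjoint)?) auto
  finally have S: "psum (blend t) j = sum T {1..<i} + T i + sum T {i<..d}" .
  have L: "sum T {1..<i} \<le> real i - 1"
  proof -
    have "sum T {1..<i} \<le> (\<Sum>i'\<in>{1..<i}. 1)"
      using assms(3) T1 by (intro sum_mono) auto
    then show ?thesis using assms(3) by simp
  qed
  have R: "sum T {i<..d} \<ge> 0"
    using T0 by (intro sum_nonneg) auto
  have L': "sum T {1..<i} = real i - 1" if pos: "T i > 0"
  proof -
    obtain s where s: "s \<in> \<tau> i" "s \<le> j"
      using Tempty[OF assms(3)] pos by fastforce
    have "T i' = 1" if "i' \<in> {1..<i}" for i'
    proof (rule Tfull)
      show i': "i' \<in> {1..d}"
        using that assms(3) by simp
      have "r \<le> s" if "r \<in> \<tau> i'" for r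
        using stairs_le[OF assms(1) i' assms(3) _ that s(1)] \<open>i' \<in> {1..<i}\<close> by simp
      then show "\<tau> i' \<subseteq> {..j}"
        using s(2) by force
    qed
    then have "sum T {1..<i} = (\<Sum>i'\<in>{1..<i}. 1)"
      by (intro sum.cong) auto
    then show ?thesis using assms(3) by simp
  qed
  have R': "sum T {i<..d} = 0" if less: "T i < 1"
  proof -
    obtain s where s: "s \<in> \<tau> i" "s > j"
    proof -
      have "\<not> \<tau> i \<subseteq> {..j}"
        using Tfull[OF assms(3)] less by linarith
      then show thesis
        using that by (meson atMost_iff linorder_not_less subsetI)
    qed
    have "T i' = 0" if "i' \<in> {i<..d}" for i'
    proof (rule Tempty)
      show i': "i' \<in> {1..d}"
        using that by simp
      have "s \<le> r" if "r \<in> \<tau> i'" for r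
        using stairs_le[OF assms(1,3) i' _ s(1) that] \<open>i' \<in> {i<..d}\<close> by simp
      then show "\<tau> i' \<inter> {..j} = {}"
        using s(2) by force
    qed
    then show ?thesis
      by (intro sum.neutral) auto
  qed
  \<comment> \<open>If \<open>T i\<close> is 0, the total is at most i - 1; if it is 1, the total is
    at least i; strictly between, the total is exactly i - 1 + \<open>T i\<close>.\<close>
  have "clamp01 (psum (blend t) j - (real i - 1)) = T i"
    unfolding clamp01_def S using L R L' R' T0[OF assms(3)] T1[OF assms(3)] by argo
  then show ?thesis
    by (simp add: T_def)
qed

text \<open>Differences of consecutive values in \<open>clamp_psum_blend\<close> recover the
  coordinates, so a point has only one decomposition along a given increasing family.\<close>

lemma overlap_blend:
  assumes "stairs \<tau>" "\<forall>i\<in>{1..d}. t i \<in> simplex_on (\<tau> i)" "i \<in> {1..d}"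
  shows "overlap (blend t) i = t i"
proof
  fix j
  \<comment> \<open>At j = 0 both cut points in \<open>overlap\<close> coincide, so the claim there
    is that \<open>t i 0\<close> vanishes.\<close>
  have "0 \<notin> \<tau> i"
    using stairs_sub[OF assms(1,3)] by force
  then have "t i 0 = 0"
    using assms(2,3) by (intro simplex_on_outside[of _ "\<tau> i"]) auto
  then show "overlap (blend t) i j = t i j"
    unfolding overlap_def clamp_psum_blend[OF assms] by (cases j) simp_all
qed

lemma psum_mono:
  assumes "x \<in> dilate" "j \<le> k"
  shows "psum x j \<le> psum x k"
  unfolding psum_def using assms by (intro sum_mono2) (auto simp: dilate_def)

lemma psum_range:
  assumes "x \<in> dilate"
  shows "0 \<le> psum x j" "psum x j \<le> real d"
proof -
  show "0 \<le> psum x j"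
    unfolding psum_def using assms by (intro sum_nonneg) (auto simp: dilate_def)
  have "psum x j \<le> psum x (max j N)"
    using assms by (intro psum_mono) auto
  also have "\<dots> = real d"
    using assms by (simp add: psum_def dilate_def)
  finally show "psum x j \<le> real d" .
qed

lemma overlap_nonneg: "x \<in> dilate \<Longrightarrow> 0 \<le> overlap x i j"
  unfolding overlap_def using psum_mono[of x "j - 1" j] clamp01_mono by (simp add: clamp01_mono)

text \<open>For j = 0 truncated subtraction gives j - 1 = 0, and for j > N the cap in
  \<open>psum\<close> takes effect: in both cases the piece has coinciding ends.\<close>

lemma overlap_outside: "j \<notin> {1..N} \<Longrightarrow> overlap x i j = 0"
proof -
  assume "j \<notin> {1..N}"
  then have "min j N = min (j - 1) N" by (cases "j = 0") auto
  then show ?thesis by (simp add: overlap_def psum_def)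
qed

lemma supp_sub: "supp x i \<subseteq> {1..N}"
  unfolding supp_def using overlap_outside by blast

text \<open>The sum telescopes between the cut points 0 and d, and [i - 1, i] lies between
  them.\<close>

lemma overlap_sum:
  assumes "x \<in> dilate" "i \<in> {1..d}"
  shows "sum (overlap x i) {1..N} = 1"
proof -
  let ?c = "\<lambda>j. clamp01 (psum x j - (real i - 1))"
  have "sum (overlap x i) {1..n} = ?c n - ?c 0" for n
    by (induction n) (auto simp: overlap_def)
  moreover have "?c N = 1" "?c 0 = 0"
    using assms by (auto simp: clamp01_def psum_def dilate_def)
  ultimately show ?thesis by simp
qed

lemma overlap_simplex:
  assumes "x \<in> dilate" "i \<in> {1..d}"
  shows "overlap x i \<in> simplex_on (supp x i)"
proof (rule simplex_onI)
  show "sum (overlap x i) {1..N} = 1"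
    using assms by (rule overlap_sum)
qed (use supp_sub overlap_nonneg[OF assms(1)] in \<open>auto simp: supp_def\<close>)

text \<open>The j-th piece lies in [0, d], so the intervals [i - 1, i] cover it and its overlaps
  with them add up to its length, the j-th coordinate of \<open>x\<close>.\<close>

lemma blend_overlap:
  assumes "x \<in> dilate"
  shows "blend (overlap x) = x"
proof -
  have "blend (overlap x) \<bullet> e j = x \<bullet> e j" if j: "j \<in> {1..N}" for j
  proof -
    have "blend (overlap x) \<bullet> e j = (\<Sum>i\<in>{1..d}. overlap x i j)"
      using j by (rule inner_blend)
    also have "\<dots> = psum x j - psum x (j - 1)"
      unfolding overlap_def sum_subtractf sum_clamp01[OF psum_range(1)[OF assms]]
      using psum_range(2)[OF assms] by (simp add: min_def)
    also have "\<dots> = x \<bullet> e j"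
      using j by (cases j) (auto simp: psum_def min_def)
    finally show ?thesis .
  qed
  then have "(\<Sum>j\<in>{1..N}. (blend (overlap x) \<bullet> e j) *\<^sub>R e j) = (\<Sum>j\<in>{1..N}. (x \<bullet> e j) *\<^sub>R e j)"
    by (intro sum.cong) auto
  then show ?thesis
    unfolding expand .
qed

text \<open>If t < s, then piece t ends no later than piece s begins. But for i < i' a piece t
  meeting the interior of [i' - 1, i'] ends beyond i' - 1, while a piece s meeting the interior of
  [i - 1, i] begins before i.\<close>

lemma stairs_supp:
  assumes "x \<in> dilate"
  shows "stairs (supp x)"
proof -
  have "s \<le> t" if "i < i'" "s \<in> supp x i" "t \<in> supp x i'" for i i' s t
  proof (rule ccontr)
    assume "\<not> s \<le> t"
    then have *: "psum x t \<le> psum x (s - 1)"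
      using assms by (intro psum_mono) auto
    have "overlap x i s > 0" "overlap x i' t > 0"
      using overlap_nonneg[OF assms] that by (auto simp: supp_def less_le)
    then have "psum x (s - 1) < real i" "psum x t > real i' - 1"
      by (auto simp: overlap_def clamp01_def min_def max_def split: if_splits)
    with * \<open>i < i'\<close> show False by linarith
  qed
  moreover have "supp x i \<noteq> {}" if "i \<in> {1..d}" for i
    using overlap_simplex[OF assms that] simplex_on_ne by blast
  ultimately show ?thesis
    unfolding stairs_def by (metis supp_sub)
qed

lemma blend_dilate:
  assumes "\<forall>i\<in>{1..d}. t i \<in> simplex_on {1..N}"
  shows "blend t \<in> dilate"
proof -
  have "(\<Sum>k\<in>{1..N}. blend t \<bullet> e k) = (\<Sum>k\<in>{1..N}. \<Sum>i\<in>{1..d}. t i k)"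
    by (intro sum.cong) (auto simp: inner_blend)
  also have "\<dots> = (\<Sum>i\<in>{1..d}. \<Sum>k\<in>{1..N}. t i k)"
    by (rule sum.swap)
  also have "\<dots> = (\<Sum>i\<in>{1..d}. 1)"
    using assms by (intro sum.cong) (auto simp: simplex_on_def)
  finally have "(\<Sum>k\<in>{1..N}. blend t \<bullet> e k) = real d" by simp
  moreover have "0 \<le> blend t \<bullet> e k" if "k \<in> {1..N}" for k
    using that assms simplex_on_nonneg by (auto simp: inner_blend intro!: sum_nonneg)
  ultimately show ?thesis
    by (simp add: dilate_def)
qed

lemma cell_mono:
  assumes "\<And>i. i \<in> {1..d} \<Longrightarrow> \<tau> i \<subseteq> \<tau>' i"
  shows "cell \<tau> \<subseteq> cell \<tau>'"
proof -
  have "convex hull (e ` \<tau> i) \<subseteq> convex hull (e ` \<tau>' i)" if "i \<in> {1..d}" for i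
    using assms[OF that] by (intro hull_mono image_mono)
  then show ?thesis
    unfolding cell_def set_sum_alt[OF finite_atLeastAtMost] by blast
qed

lemma cell_full: "cell (\<lambda>_. {1..N}) \<subseteq> dilate"
  using blend_dilate by (subst cell_eq) auto

text \<open>The only decomposition of a point along the family is the one given by
  \<open>overlap\<close>. Membership thus becomes a condition on supports, from which the arguments
  on faces and intersections start.\<close>

lemma cell_iff:
  assumes "stairs \<tau>"
  shows "x \<in> cell \<tau> \<longleftrightarrow> x \<in> dilate \<and> (\<forall>i\<in>{1..d}. supp x i \<subseteq> \<tau> i)"
proof
  assume x: "x \<in> cell \<tau>"
  then obtain t where t: "x = blend t" "\<forall>i\<in>{1..d}. t i \<in> simplex_on (\<tau> i)"
    using cell_eq[of \<tau>] stairs_sub[OF assms] by blast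
  have "supp x i \<subseteq> \<tau> i" if "i \<in> {1..d}" for i
    using overlap_blend[OF assms t(2) that] t simplex_on_outside that
    unfolding supp_def t(1) by fastforce
  moreover have "x \<in> dilate"
    using x cell_mono[of \<tau> "\<lambda>_. {1..N}"] stairs_sub[OF assms] cell_full by blast
  ultimately show "x \<in> dilate \<and> (\<forall>i\<in>{1..d}. supp x i \<subseteq> \<tau> i)"
    by blast
next
  assume x: "x \<in> dilate \<and> (\<forall>i\<in>{1..d}. supp x i \<subseteq> \<tau> i)"
  have "\<forall>i\<in>{1..d}. overlap x i \<in> simplex_on (\<tau> i)"
    using x stairs_sub[OF assms] finite_subset
    by (meson finite_atLeastAtMost overlap_simplex simplex_on_mono)
  then have "blend (overlap x) \<in> cell \<tau>"
    using cell_eq[of \<tau>] stairs_sub[OF assms] by blast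
  then show "x \<in> cell \<tau>"
    using blend_overlap x by simp
qed

lemma overlap_cell:
  assumes "stairs \<tau>" "x \<in> cell \<tau>" "i \<in> {1..d}"
  shows "overlap x i \<in> simplex_on (\<tau> i)"
proof (rule simplex_on_mono)
  show "overlap x i \<in> simplex_on (supp x i)"
    using assms cell_iff by (intro overlap_simplex) auto
  show "supp x i \<subseteq> \<tau> i"
    using assms cell_iff by blast
  show "finite (\<tau> i)"
    using stairs_sub[OF assms(1,3)] finite_subset by blast
qed

subsection \<open>Faces\<close>

lemma cell_cong: "(\<And>i. i \<in> {1..d} \<Longrightarrow> \<tau> i = \<tau>' i) \<Longrightarrow> cell \<tau> = cell \<tau>'"
  unfolding cell_def by (intro sum.cong) auto

lemma blend_comb: "blend (\<lambda>i j. p * s i j + q * t i j) = p *\<^sub>R blend s + q *\<^sub>R blend t"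
  by (simp add: blend_def scaleR_add_left sum.distrib scaleR_sum_right)

lemma polytope_cell:
  assumes "stairs \<tau>"
  shows "polytope (cell \<tau>)"
proof -
  have "finite (\<tau> i)" if "i \<in> {1..d}" for i
    using stairs_sub[OF assms that] finite_subset by blast
  then have "finite (\<Sum>i\<in>{1..d}. e ` \<tau> i)"
    by (intro finite_set_sum) auto
  then show ?thesis
    unfolding cell_def polytope_def convex_hull_set_sum[symmetric] by blast
qed

lemma cell_singletons: "cell (\<lambda>i. {v i}) = {\<Sum>i\<in>{1..d}. e (v i)}"
proof -
  have "(\<Sum>i\<in>A. {a i}) = {\<Sum>i\<in>A. a i}" for A and a :: "nat \<Rightarrow> 'a"
    by (induction A rule: infinite_finite_induct) (simp_all add: set_plus_def flip: set_zero)
  then show ?thesis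
    unfolding cell_def convex_hull_singleton image_insert image_empty .
qed

lemma vertex_in_cell:
  assumes "\<And>i. i \<in> {1..d} \<Longrightarrow> v i \<in> \<tau> i"
  shows "(\<Sum>i\<in>{1..d}. e (v i)) \<in> cell \<tau>"
proof -
  have "cell (\<lambda>i. {v i}) \<subseteq> cell \<tau>"
    using assms by (intro cell_mono) simp
  then show ?thesis
    unfolding cell_singletons by simp
qed

lemma cell_nonempty:
  assumes "stairs \<tau>"
  shows "cell \<tau> \<noteq> {}"
proof -
  have "\<forall>i\<in>{1..d}. \<exists>j. j \<in> \<tau> i"
    using assms unfolding stairs_def by blast
  then obtain v where "\<And>i. i \<in> {1..d} \<Longrightarrow> v i \<in> \<tau> i"
    by metis
  then show ?thesis
    using vertex_in_cell by blast
qed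

text \<open>Clamping is not linear, but \<open>overlap\<close> is affine on each cell: combining the
  decompositions of \<open>a\<close> and \<open>b\<close> gives a decomposition of the combined
  point along the same family, and that one is unique.\<close>

lemma overlap_comb:
  assumes "stairs \<tau>" "a \<in> cell \<tau>" "b \<in> cell \<tau>" "0 \<le> u" "u \<le> 1" "i \<in> {1..d}"
  shows "overlap ((1 - u) *\<^sub>R a + u *\<^sub>R b) i = (\<lambda>j. (1 - u) * overlap a i j + u * overlap b i j)"
proof -
  have "a \<in> dilate" "b \<in> dilate"
    using assms cell_iff by blast+
  then have "(1 - u) *\<^sub>R a + u *\<^sub>R b = blend (\<lambda>i j. (1 - u) * overlap a i j + u * overlap b i j)"
    by (simp add: blend_comb blend_overlap)
  moreover have "\<forall>i\<in>{1..d}. (\<lambda>j. (1 - u) * overlap a i j + u * overlap b i j) \<in> simplex_on (\<tau> i)"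
    using overlap_cell assms(1-5) by (intro ballI simplex_on_convex) auto
  ultimately show ?thesis
    using overlap_blend[OF assms(1) _ assms(6)] by simp
qed

text \<open>Overlaps are nonnegative and both weights are positive, so nothing cancels.\<close>

lemma supp_comb:
  assumes "stairs \<tau>" "a \<in> cell \<tau>" "b \<in> cell \<tau>" "0 < u" "u < 1" "i \<in> {1..d}"
  shows "supp ((1 - u) *\<^sub>R a + u *\<^sub>R b) i = supp a i \<union> supp b i"
proof -
  have "a \<in> dilate" "b \<in> dilate"
    using assms cell_iff by blast+
  then have "0 \<le> (1 - u) * overlap a i j" "0 \<le> u * overlap b i j" for j
    using assms(4,5) overlap_nonneg by auto
  then have "(1 - u) * overlap a i j + u * overlap b i j = 0 \<longleftrightarrow>
      (1 - u) * overlap a i j = 0 \<and> u * overlap b i j = 0" for j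
    by (rule add_nonneg_eq_0_iff)
  then show ?thesis
    using assms by (auto simp: supp_def overlap_comb[OF assms(1-3) _ _ assms(6)])
qed

text \<open>By \<open>supp_comb\<close> the support of an inner point of a segment contains the
  supports of both ends. If the inner point lies in the subcell, so do the ends.\<close>

lemma subcell_face:
  assumes "stairs \<tau>" "\<And>i. i \<in> {1..d} \<Longrightarrow> \<tau>' i \<subseteq> \<tau> i" "\<And>i. i \<in> {1..d} \<Longrightarrow> \<tau>' i \<noteq> {}"
  shows "cell \<tau>' face_of cell \<tau>"
  unfolding face_of_def
proof (intro conjI ballI impI)
  have st: "stairs \<tau>'"
    using assms by (rule stairs_subfamily)
  show "cell \<tau>' \<subseteq> cell \<tau>"
    using assms(2) by (rule cell_mono)
  show "convex (cell \<tau>')"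
    using polytope_cell[OF st] by (rule polytope_imp_convex)
  fix a b x
  assume a: "a \<in> cell \<tau>" and b: "b \<in> cell \<tau>" and x: "x \<in> cell \<tau>'" "x \<in> open_segment a b"
  then obtain u where u: "0 < u" "u < 1" "x = (1 - u) *\<^sub>R a + u *\<^sub>R b"
    by (auto simp: in_segment)
  have "supp a i \<union> supp b i \<subseteq> \<tau>' i" if "i \<in> {1..d}" for i
    using supp_comb[OF assms(1) a b u(1,2) that] x(1) that cell_iff[OF st] u(3) by blast
  moreover have "a \<in> dilate" "b \<in> dilate"
    using a b cell_iff[OF assms(1)] by blast+
  ultimately show "a \<in> cell \<tau>'" "b \<in> cell \<tau>'"
    using cell_iff[OF st] by blast+
qed

text \<open>
  Each \<open>x\<close> is a relative interior point of the cell of its support: a segment from a point of that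
  cell to \<open>x\<close> can be prolonged beyond \<open>x\<close>.
\<close>

lemma extend_past:
  assumes "x \<in> dilate" "z \<in> cell (supp x)"
  obtains u w where "0 < u" "u < 1" "w \<in> cell (supp x)" "x = (1 - u) *\<^sub>R z + u *\<^sub>R w"
proof -
  let ?A = "(\<lambda>(i, j). overlap x i j) ` (SIGMA i:{1..d}. supp x i)"
  \<comment> \<open>The least positive coordinate of \<open>x\<close>, capped at 1. The coordinates
    of \<open>z\<close> are at most 1, so subtracting \<open>m\<close> times \<open>z\<close> in
    \<open>t\<close> below leaves nonnegative coordinates.\<close>
  define m where "m = Min (insert 1 ?A)"
  have fin: "finite (insert 1 ?A)"
    using supp_sub finite_subset by (intro finite.insertI finite_imageI finite_SigmaI) blast+
  have st: "stairs (supp x)"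
    using assms(1) by (rule stairs_supp)
  have zd: "z \<in> dilate"
    using assms(2) cell_iff[OF st] by blast
  have "0 < overlap x i j" if "j \<in> supp x i" for i j
    using that overlap_nonneg[OF assms(1), of i j] by (auto simp: supp_def)
  then have m0: "0 < m"
    unfolding m_def using fin by (subst Min_gr_iff) auto
  have m: "m \<le> overlap x i j" if "i \<in> {1..d}" "j \<in> supp x i" for i j
    unfolding m_def using fin that by (intro Min_le) auto
  define t where "t = (\<lambda>i j. (1 + m) * overlap x i j + (- m) * overlap z i j)"
  have t: "t i \<in> simplex_on (supp x i)" if i: "i \<in> {1..d}" for i
  proof (rule simplex_onI[of "{1..N}"])
    have oz: "overlap z i \<in> simplex_on (supp x i)"
      using overlap_cell[OF st assms(2) i] .
    show out: "t i j = 0" if "j \<notin> supp x i" for j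
      using that simplex_on_outside[OF oz that] by (simp add: t_def supp_def)
    have fs: "finite (supp x i)"
      using supp_sub finite_subset by blast
    show "0 \<le> t i j" for j
    proof (cases "j \<in> supp x i")
      case True
      have "m * overlap z i j \<le> m * 1"
        using simplex_on_le_1[OF oz fs] m0 by (intro mult_left_mono) auto
      moreover have "m \<le> overlap x i j"
        using m i True by blast
      moreover have "0 \<le> m * overlap x i j"
        using m0 overlap_nonneg[OF assms(1)] by simp
      ultimately show ?thesis
        unfolding t_def by (simp add: distrib_right)
    qed (simp add: out)
    have "sum (t i) {1..N} = (1 + m) * sum (overlap x i) {1..N} + (- m) * sum (overlap z i) {1..N}"
      unfolding t_def sum.distrib sum_distrib_left ..
    then show "sum (t i) {1..N} = 1"
      unfolding overlap_sum[OF assms(1) i] overlap_sum[OF zd i] by simp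
  qed (use supp_sub in auto)
  have "blend t = (1 + m) *\<^sub>R x - m *\<^sub>R z"
    unfolding t_def blend_comb blend_overlap[OF assms(1)] blend_overlap[OF zd] by simp
  \<comment> \<open>Solving \<open>blend t = (1 + m) *\<^sub>R x - m *\<^sub>R z\<close> for
    \<open>x\<close> puts \<open>x\<close> on the segment from \<open>z\<close> to
    \<open>blend t\<close>, at parameter 1 / (1 + m).\<close>
  moreover have "1 - 1 / (1 + m) = 1 / (1 + m) * m" "1 / (1 + m) * (1 + m) = 1"
    using m0 by (simp_all add: field_simps)
  ultimately have "x = (1 - 1 / (1 + m)) *\<^sub>R z + (1 / (1 + m)) *\<^sub>R blend t"
    by (simp only: scaleR_diff_right scaleR_scaleR) simp
  moreover have "blend t \<in> cell (supp x)"
    using t cell_eq[of "supp x"] supp_sub by blast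
  ultimately show thesis
    using m0 by (intro that[of "1 / (1 + m)" "blend t"]) auto
qed

text \<open>Converse to \<open>subcell_face\<close>. Maximality of the support of \<open>x\<close>
  bounds the supports of all points of \<open>F\<close>. Conversely, by \<open>extend_past\<close>,
  \<open>x\<close> is inside a segment from any \<open>z\<close> of the cell of its support, and the
  face property pulls \<open>z\<close> into \<open>F\<close>.\<close>

lemma face_of_cell:
  assumes "stairs \<tau>" "F face_of cell \<tau>" "F \<noteq> {}"
  obtains \<tau>' where "\<And>i. i \<in> {1..d} \<Longrightarrow> \<tau>' i \<subseteq> \<tau> i" "\<And>i. i \<in> {1..d} \<Longrightarrow> \<tau>' i \<noteq> {}" "F = cell \<tau>'"
proof -
  \<comment> \<open>A point of \<open>F\<close> of largest support: its support is that of the face.\<close>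
  let ?c = "\<lambda>x. \<Sum>i\<in>{1..d}. card (supp x i)"
  have sub: "F \<subseteq> cell \<tau>"
    using assms(2) by (rule face_of_imp_subset)
  have fs: "finite (supp x i)" for x i
    using supp_sub finite_subset by blast
  have "?c x \<le> d * N" for x
  proof -
    have "?c x \<le> (\<Sum>i\<in>{1..d}. card {1..N})"
      using supp_sub by (intro sum_mono card_mono) auto
    then show ?thesis by simp
  qed
  then have bound: "\<forall>y. y \<in> F \<longrightarrow> ?c y < Suc (d * N)"
    by (simp add: less_Suc_eq_le)
  obtain x0 where "x0 \<in> F"
    using assms(3) by blast
  then have "\<exists>x. x \<in> F \<and> (\<forall>y. y \<in> F \<longrightarrow> ?c y \<le> ?c x)"
    using bound by (rule Lattices_Big.ex_has_greatest_nat)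
  then obtain x where x: "x \<in> F" "\<And>y. y \<in> F \<Longrightarrow> ?c y \<le> ?c x"
    by blast
  have xd: "x \<in> dilate"
    using x(1) sub cell_iff[OF assms(1)] by blast
  have st: "stairs (supp x)"
    using xd by (rule stairs_supp)
  have "supp y i \<subseteq> supp x i" if y: "y \<in> F" and i: "i \<in> {1..d}" for y i
  proof (rule ccontr)
    assume *: "\<not> supp y i \<subseteq> supp x i"
    \<comment> \<open>The midpoint stays in \<open>F\<close> by convexity, and its support, the
      union of both supports, would exceed that of \<open>x\<close>.\<close>
    let ?z = "(1 - 1 / 2) *\<^sub>R x + (1 / 2 :: real) *\<^sub>R y"
    have "?z \<in> F"
      using face_of_imp_convex[OF assms(2)] x(1) y by (intro convexD) auto
    then have "?c ?z \<le> ?c x"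
      by (rule x(2))
    moreover have z: "supp ?z k = supp x k \<union> supp y k" if "k \<in> {1..d}" for k
      using x(1) y sub that by (intro supp_comb[OF assms(1)]) auto
    have "?c x < ?c ?z"
    proof (rule sum_strict_mono_ex1)
      show "\<forall>k\<in>{1..d}. card (supp x k) \<le> card (supp ?z k)"
        using z fs by (auto intro!: card_mono)
      show "\<exists>k\<in>{1..d}. card (supp x k) < card (supp ?z k)"
        using z[OF i] fs * i by (intro bexI[of _ i] psubset_card_mono) auto
    qed simp
    ultimately show False by linarith
  qed
  then have "F \<subseteq> cell (supp x)"
    using sub cell_iff[OF st] cell_iff[OF assms(1)] by blast
  moreover have "z \<in> F" if z: "z \<in> cell (supp x)" for z
  proof -
    obtain u w where u: "0 < u" "u < 1" "w \<in> cell (supp x)" "x = (1 - u) *\<^sub>R z + u *\<^sub>R w"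
      using extend_past[OF xd z] .
    have cs: "cell (supp x) \<subseteq> cell \<tau>"
      using x(1) sub cell_iff[OF assms(1)] by (intro cell_mono) blast
    show ?thesis
    \<comment> \<open>For \<open>z = w\<close> the open segment is empty and the face property says
      nothing, but then \<open>x\<close> is \<open>z\<close>.\<close>
    proof (cases "z = w")
      case True
      then have "x = z"
        using u(4) by (simp add: scaleR_left_distrib[symmetric])
      then show ?thesis
        using x(1) by simp
    next
      case False
      then have "x \<in> open_segment z w"
        using u by (auto simp: in_segment)
      then show ?thesis
        using face_ofD[OF assms(2) _ _ _ x(1)] z u(3) cs by blast
    qed
  qed
  ultimately have F: "F = cell (supp x)"
    by blast
  have x_cell: "x \<in> cell \<tau>"
    using x(1) sub by blast
  show thesis
  proof (rule that[of "supp x"])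
    show "supp x i \<subseteq> \<tau> i" if "i \<in> {1..d}" for i
      using that x_cell cell_iff[OF assms(1), of x] by blast
    show "supp x i \<noteq> {}" if "i \<in> {1..d}" for i
      using that st unfolding stairs_def by blast
  qed (rule F)
qed

text \<open>Extreme points are singleton faces. Such a face is a subcell by
  \<open>face_of_cell\<close>, and any choice of one vertex per factor names its only point.\<close>

lemma extreme_point_cell:
  assumes "stairs \<tau>"
  shows "x extreme_point_of cell \<tau> \<longleftrightarrow> (\<exists>v. (\<forall>i\<in>{1..d}. v i \<in> \<tau> i) \<and> x = (\<Sum>i\<in>{1..d}. e (v i)))"
proof
  assume "x extreme_point_of cell \<tau>"
  then have "{x} face_of cell \<tau>"
    by (simp add: face_of_singleton)
  then obtain \<tau>' where \<tau>': "\<And>i. i \<in> {1..d} \<Longrightarrow> \<tau>' i \<subseteq> \<tau> i" "\<And>i. i \<in> {1..d} \<Longrightarrow> \<tau>' i \<noteq> {}" "{x} = cell \<tau>'"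
    using face_of_cell[OF assms] by blast
  then have "\<forall>i\<in>{1..d}. \<exists>j. j \<in> \<tau>' i"
    by blast
  then obtain v where v: "\<And>i. i \<in> {1..d} \<Longrightarrow> v i \<in> \<tau>' i"
    by metis
  then have "(\<Sum>i\<in>{1..d}. e (v i)) = x"
    using vertex_in_cell[of v \<tau>'] \<tau>'(3) by blast
  then show "\<exists>v. (\<forall>i\<in>{1..d}. v i \<in> \<tau> i) \<and> x = (\<Sum>i\<in>{1..d}. e (v i))"
    using v \<tau>'(1) by blast
next
  assume "\<exists>v. (\<forall>i\<in>{1..d}. v i \<in> \<tau> i) \<and> x = (\<Sum>i\<in>{1..d}. e (v i))"
  then obtain v where v: "\<forall>i\<in>{1..d}. v i \<in> \<tau> i" "x = (\<Sum>i\<in>{1..d}. e (v i))"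
    by blast
  have "cell (\<lambda>i. {v i}) face_of cell \<tau>"
    using v(1) by (intro subcell_face[OF assms]) auto
  then show "x extreme_point_of cell \<tau>"
    by (simp add: cell_singletons v(2) face_of_singleton)
qed

text \<open>In terms of supports, two cells meet in the cell of the intersected family. Its sets are
  nonempty once there is a common point, since they contain the support of that point.\<close>

lemma cell_Int_face:
  assumes "stairs \<tau>" "stairs \<tau>'"
  shows "(cell \<tau> \<inter> cell \<tau>') face_of cell \<tau>"
proof (cases "cell \<tau> \<inter> cell \<tau>' = {}")
  case False
  then obtain y where y: "y \<in> cell \<tau>" "y \<in> cell \<tau>'"
    by blast
  let ?\<rho> = "\<lambda>i. \<tau> i \<inter> \<tau>' i"
  have ne: "?\<rho> i \<noteq> {}" if "i \<in> {1..d}" for i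
  proof -
    have "supp y i \<noteq> {}"
      using y(1) cell_iff[OF assms(1)] stairs_supp that unfolding stairs_def by blast
    moreover have "supp y i \<subseteq> ?\<rho> i"
      using y that cell_iff assms by blast
    ultimately show ?thesis by blast
  qed
  then have st: "stairs ?\<rho>"
    by (intro stairs_subfamily[OF assms(1)]) auto
  have "cell \<tau> \<inter> cell \<tau>' = cell ?\<rho>"
    using cell_iff[OF assms(1)] cell_iff[OF assms(2)] cell_iff[OF st] by blast
  moreover have "cell ?\<rho> face_of cell \<tau>"
    using ne by (intro subcell_face[OF assms(1)]) auto
  ultimately show ?thesis by simp
qed simp

subsection \<open>Comparison with products of simplices\<close>

text \<open>Adding i - 1 to the i-th entry turns weakly increasing sequences into strictly
  increasing ones, as in the vertex labels.\<close>

definition shift :: "(nat \<Rightarrow> nat set) \<Rightarrow> nat \<Rightarrow> nat set" where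
  "shift \<tau> i = (\<lambda>j. j + (i - 1)) ` \<tau> i"

text \<open>Restricting to \<open>{1..d}\<close> makes the values extensional, as membership in
  \<open>product_cell\<close> demands. For v < i - 1 the overlap is taken at 0, where it
  vanishes.\<close>

definition chart :: "'a \<Rightarrow> nat \<Rightarrow> nat \<Rightarrow> real" where
  "chart x = (\<lambda>i\<in>{1..d}. \<lambda>v. overlap x i (v - (i - 1)))"

definition unchart :: "(nat \<Rightarrow> nat \<Rightarrow> real) \<Rightarrow> 'a" where
  "unchart y = blend (\<lambda>i j. y i (j + (i - 1)))"

lemma continuous_chart: "continuous_on S chart"
proof (intro continuous_on_coordinatewise_then_product)
  fix i v
  have "continuous_on S (\<lambda>x. overlap x i j)" for j
    unfolding overlap_def clamp01_def psum_def by (intro continuous_intros)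
  then show "continuous_on S (\<lambda>x. chart x i v)"
    unfolding chart_def by (cases "i \<in> {1..d}") auto
qed

lemma continuous_unchart: "continuous_on S unchart"
proof -
  have "continuous_on UNIV (\<lambda>y :: nat \<Rightarrow> nat \<Rightarrow> real. y i j)" for i j
    by (rule continuous_on_product_then_coordinatewise[OF continuous_on_product_coordinates])
  then have "continuous_on S (\<lambda>y :: nat \<Rightarrow> nat \<Rightarrow> real. y i j)" for i j
    by (rule continuous_on_subset) simp
  then show ?thesis
    unfolding unchart_def blend_def by (intro continuous_on_sum continuous_on_scaleR continuous_on_const)
qed

lemma unchart_chart:
  assumes "x \<in> dilate"
  shows "unchart (chart x) = x"
proof -
  have "unchart (chart x) = blend (overlap x)"
    unfolding unchart_def by (intro blend_cong) (simp add: chart_def)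
  then show ?thesis
    using blend_overlap[OF assms] by simp
qed

lemma chart_in:
  assumes "stairs \<tau>" "x \<in> cell \<tau>"
  shows "chart x \<in> product_cell d (shift \<tau>)"
  unfolding product_cell_def chart_def
proof (rule restrict_PiE_iff[THEN iffD2], rule ballI)
  fix i assume i: "i \<in> {1..d}"
  then have "0 \<notin> \<tau> i"
    using stairs_sub[OF assms(1) i] by force
  then show "(\<lambda>v. overlap x i (v - (i - 1))) \<in> simplex_on (shift \<tau> i)"
    unfolding shift_def using overlap_cell[OF assms i] by (intro simplex_on_shift)
qed

lemma unchart_in:
  assumes "stairs \<tau>" "y \<in> product_cell d (shift \<tau>)"
  shows "unchart y \<in> cell \<tau>" "chart (unchart y) = y"
proof -
  define t where "t i j = y i (j + (i - 1))" for i j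
  have y: "y i \<in> simplex_on ((\<lambda>j. j + (i - 1)) ` \<tau> i)" if "i \<in> {1..d}" for i
    using assms(2) that unfolding product_cell_def shift_def by blast
  have t: "\<forall>i\<in>{1..d}. t i \<in> simplex_on (\<tau> i)"
    unfolding t_def using y by (intro ballI simplex_on_unshift)
  have ub: "unchart y = blend t"
    unfolding unchart_def t_def ..
  then show "unchart y \<in> cell \<tau>"
    using t cell_eq[of \<tau>] stairs_sub[OF assms(1)] by blast
  show "chart (unchart y) = y"
  proof
    fix i
    show "chart (unchart y) i = y i"
    proof (cases "i \<in> {1..d}")
      case True
      have "t i (v - (i - 1)) = y i v" for v
      proof (cases "i - 1 \<le> v")
        case False
        \<comment> \<open>Here \<open>v - (i - 1)\<close> is 0, so the left side is
          \<open>y i (i - 1)\<close>. Both \<open>i - 1\<close> and \<open>v\<close> lie below the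
          shifted set, whose elements are at least i.\<close>
        have "0 \<notin> \<tau> i"
          using stairs_sub[OF assms(1) True] by force
        then have "i - 1 \<notin> (\<lambda>j. j + (i - 1)) ` \<tau> i"
          by auto
        moreover have "v \<notin> (\<lambda>j. j + (i - 1)) ` \<tau> i"
          using False by auto
        ultimately have "y i (i - 1) = 0" "y i v = 0"
          using simplex_on_outside[OF y[OF True]] by blast+
        then show ?thesis
          using False by (simp add: t_def)
      qed (simp add: t_def)
      moreover have "chart (unchart y) i = (\<lambda>v. t i (v - (i - 1)))"
        unfolding ub chart_def restrict_apply'[OF True] overlap_blend[OF assms(1) t True] ..
      ultimately show ?thesis by simp
    next
      case False
      then show ?thesis
        using assms(2) unfolding product_cell_def chart_def by (auto simp: PiE_def extensional_def)
    qed
  qed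
qed

lemma chart_image:
  assumes "stairs \<tau>"
  shows "chart ` cell \<tau> = product_cell d (shift \<tau>)"
  using chart_in[OF assms] unchart_in[OF assms] by (metis image_eqI image_subsetI subsetI subset_antisym)

text \<open>\<open>chart\<close> and \<open>unchart\<close> do not depend on the family, so the
  bijections of the single cells are restrictions of one pair of continuous maps and agree wherever
  cells meet.\<close>

lemma isomorphic_cells:
  assumes "\<And>\<tau>. \<tau> \<in> T \<Longrightarrow> stairs \<tau>"
  shows "cell_complex_isomorphic (cell ` T) ((\<lambda>\<tau>. product_cell d (shift \<tau>)) ` T)"
    "cell_complex_isomorphic ((\<lambda>\<tau>. product_cell d (shift \<tau>)) ` T) (cell ` T)"
proof -
  let ?K = "cell ` T" and ?L = "(\<lambda>\<tau>. product_cell d (shift \<tau>)) ` T"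
  have left: "unchart (chart x) = x" if "x \<in> \<Union>?K" for x
    using that assms cell_iff unchart_chart by blast
  have right: "chart (unchart y) = y" if "y \<in> \<Union>?L" for y
    using that assms unchart_in by blast
  have im: "chart ` cell \<tau> = product_cell d (shift \<tau>)" if "\<tau> \<in> T" for \<tau>
    using chart_image assms that by blast
  have im': "unchart ` product_cell d (shift \<tau>) = cell \<tau>" if "\<tau> \<in> T" for \<tau>
  proof -
    have "unchart ` chart ` cell \<tau> = id ` cell \<tau>"
      unfolding image_image using that by (intro image_cong refl) (auto intro: left[simplified])
    then show ?thesis
      using im[OF that] by simp
  qed
  have homeo: "homeomorphism (\<Union>?K) (\<Union>?L) chart unchart"
  proof (rule homeomorphismI)
    show "chart ` \<Union>?K \<subseteq> \<Union>?L" "unchart ` \<Union>?L \<subseteq> \<Union>?K"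
      using im im' by blast+
  qed (use left right continuous_chart continuous_unchart in auto)
  have "bij_betw (\<lambda>C. chart ` C) ?K ?L"
    by (rule bij_betw_byWitness[where f' = "\<lambda>D. unchart ` D"]) (use im im' in auto)
  then show "cell_complex_isomorphic ?K ?L"
    unfolding cell_complex_isomorphic_def using homeo by blast
  have "bij_betw (\<lambda>D. unchart ` D) ?L ?K"
    by (rule bij_betw_byWitness[where f' = "\<lambda>C. chart ` C"]) (use im im' in auto)
  then show "cell_complex_isomorphic ?L ?K"
    unfolding cell_complex_isomorphic_def using homeomorphism_symD[OF homeo] by blast
qed

section \<open>The complex of the hypergraph in terms of increasing families\<close>

definition stairs_in :: "nat set set \<Rightarrow> (nat \<Rightarrow> nat set) \<Rightarrow> bool" where
  "stairs_in E \<tau> \<longleftrightarrow> stairs \<tau> \<and>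
    (\<forall>v. (\<forall>i\<in>{1..d}. v i \<in> \<tau> i) \<longrightarrow> (\<lambda>i. v i + (i - 1)) ` {1..d} \<in> E)"

text \<open>Each passage to the next set gains at least 1, and the nonempty sets in between supply
  elements to pass through.\<close>

lemma chain_gap:
  assumes "\<And>i. i \<in> {1..d} \<Longrightarrow> \<sigma> i \<noteq> {}"
    and "\<And>i j. i \<in> {1..d} \<Longrightarrow> j \<in> {1..d} \<Longrightarrow> i < j \<Longrightarrow> set_less (\<sigma> i) (\<sigma> j)"
    and "1 \<le> i" "i < j" "j \<le> d" "s \<in> \<sigma> i" "t \<in> \<sigma> j"
  shows "s + (j - i) \<le> t"
  using assms(4,5,7)
proof (induction j arbitrary: t)
  case (Suc j)
  show ?case
  proof (cases "i = j")
    case True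
    have "set_less (\<sigma> i) (\<sigma> (Suc j))"
      using Suc.prems True assms(3) by (intro assms(2)) auto
    then show ?thesis
      using Suc.prems assms(6) True by (auto simp: set_less_def Suc_le_eq)
  next
    case False
    then obtain u where u: "u \<in> \<sigma> j"
      using Suc.prems assms(1)[of j] assms(3) by fastforce
    have "s + (j - i) \<le> u"
      using Suc False u by simp
    moreover have "set_less (\<sigma> j) (\<sigma> (Suc j))"
      using Suc.prems False assms(3) by (intro assms(2)) auto
    then have "u < t"
      using u Suc.prems by (simp add: set_less_def)
    ultimately show ?thesis
      using False Suc.prems by linarith
  qed
qed simp

text \<open>The shift can be undone because \<open>chain_gap\<close> confines the elements of
  \<open>\<sigma> i\<close> to the range from i to n - d + i; subtracting i - 1 lands in
  \<open>{1..N}\<close>.\<close>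

lemma X_graph_eq:
  assumes "N = n - d + 1" "d \<le> n"
  shows "X_graph n d E = (\<lambda>\<tau>. product_cell d (shift \<tau>)) ` {\<tau>. stairs_in E \<tau>}"
proof (intro equalityI subsetI)
  fix C assume "C \<in> X_graph n d E"
  then obtain \<sigma> where C: "C = product_cell d \<sigma>"
    and all: "\<forall>i\<in>{1..d}. \<sigma> i \<noteq> {} \<and> \<sigma> i \<subseteq> {1..n}"
      "\<forall>i\<in>{1..d}. \<forall>j\<in>{1..d}. i < j \<longrightarrow> set_less (\<sigma> i) (\<sigma> j)"
      "\<forall>v. (\<forall>i\<in>{1..d}. v i \<in> \<sigma> i) \<longrightarrow> v ` {1..d} \<in> E"
    unfolding X_graph_def mem_Collect_eq by (elim exE conjE)
  have ne: "\<sigma> i \<noteq> {}" and sub: "\<sigma> i \<subseteq> {1..n}" if "i \<in> {1..d}" for i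
    using all(1) that by blast+
  have less: "set_less (\<sigma> i) (\<sigma> j)" if "i \<in> {1..d}" "j \<in> {1..d}" "i < j" for i j
    using all(2) that by blast
  define \<tau> where "\<tau> i = (\<lambda>v. v - (i - 1)) ` \<sigma> i" for i
  have gap: "s + (j - i) \<le> t" if "1 \<le> i" "i < j" "j \<le> d" "s \<in> \<sigma> i" "t \<in> \<sigma> j" for i j s t
    using ne less that by (rule chain_gap)
  \<comment> \<open>Elements of \<open>\<sigma> 1\<close> are at least 1, and i - 1 gaps follow.
    Hence subtracting i - 1 is not truncated and leaves at least 1.\<close>
  have lower: "i \<le> v" if i: "i \<in> {1..d}" and v: "v \<in> \<sigma> i" for i v
  proof (cases "i = 1")
    case True
    then show ?thesis using sub[OF i] v by auto
  next
    case False
    obtain u where u: "u \<in> \<sigma> 1"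
      using ne[of 1] d_pos by auto
    then have "1 \<le> u"
      using sub[of 1] d_pos by auto
    moreover have "u + (i - 1) \<le> v"
      using gap[OF _ _ _ u v] False i by simp
    ultimately show ?thesis by linarith
  qed
  \<comment> \<open>Symmetrically, d - i gaps remain before \<open>\<sigma> d\<close>, whose
    elements are at most n.\<close>
  have upper: "v + (d - i) \<le> n" if i: "i \<in> {1..d}" and v: "v \<in> \<sigma> i" for i v
  proof (cases "i = d")
    case True
    then show ?thesis using sub[OF i] v by auto
  next
    case False
    obtain u where u: "u \<in> \<sigma> d"
      using ne[of d] d_pos by auto
    then have "u \<le> n"
      using sub[of d] d_pos by auto
    moreover have "v + (d - i) \<le> u"
      using gap[OF _ _ _ v u] False i by simp
    ultimately show ?thesis by linarith
  qed
  have sh: "shift \<tau> i = \<sigma> i" if i: "i \<in> {1..d}" for i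
  proof -
    have "shift \<tau> i = (\<lambda>v. v) ` \<sigma> i"
      unfolding shift_def \<tau>_def image_image
    proof (rule image_cong[OF refl])
      fix v assume "v \<in> \<sigma> i"
      then show "v - (i - 1) + (i - 1) = v"
        using lower[OF i] by (metis diff_le_self le_add_diff_inverse2 le_trans)
    qed
    then show ?thesis by simp
  qed
  have "stairs \<tau>"
    unfolding stairs_def
  proof (intro conjI ballI impI)
    fix i assume i: "i \<in> {1..d}"
    show "\<tau> i \<noteq> {}"
      using ne[OF i] by (simp add: \<tau>_def)
    show "\<tau> i \<subseteq> {1..N}"
    proof
      fix j assume "j \<in> \<tau> i"
      then obtain v where v: "v \<in> \<sigma> i" "j = v - (i - 1)"
        by (auto simp: \<tau>_def)
      then show "j \<in> {1..N}"
        using lower[OF i v(1)] upper[OF i v(1)] i assms by auto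
    qed
  next
    fix i j s t
    assume i: "i \<in> {1..d}" "j \<in> {1..d}" "i < j" and s: "s \<in> \<tau> i" and t: "t \<in> \<tau> j"
    obtain s' t' where st: "s' \<in> \<sigma> i" "s = s' - (i - 1)" "t' \<in> \<sigma> j" "t = t' - (j - 1)"
      using s t by (auto simp: \<tau>_def)
    then have "s' + (j - i) \<le> t'"
      using i by (intro gap) auto
    then show "s \<le> t"
      using st i by auto
  qed
  moreover have "(\<lambda>i. v i + (i - 1)) ` {1..d} \<in> E" if "\<forall>i\<in>{1..d}. v i \<in> \<tau> i" for v
  proof (rule all(3)[rule_format])
    fix i assume i: "i \<in> {1..d}"
    then have "v i + (i - 1) \<in> shift \<tau> i"
      using that by (simp add: shift_def)
    then show "v i + (i - 1) \<in> \<sigma> i"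
      using sh[OF i] by simp
  qed
  \<comment> \<open>The two families may differ outside \<open>{1..d}\<close>, but a product cell
    sees only these indices.\<close>
  moreover have "C = product_cell d (shift \<tau>)"
    unfolding C product_cell_def by (intro PiE_cong) (simp add: sh)
  ultimately show "C \<in> (\<lambda>\<tau>. product_cell d (shift \<tau>)) ` {\<tau>. stairs_in E \<tau>}"
    unfolding stairs_in_def by blast
next
  fix C assume "C \<in> (\<lambda>\<tau>. product_cell d (shift \<tau>)) ` {\<tau>. stairs_in E \<tau>}"
  then obtain \<tau> where C: "C = product_cell d (shift \<tau>)" and in_E: "stairs_in E \<tau>"
    by blast
  have st: "stairs \<tau>"
    using in_E unfolding stairs_in_def by (rule conjunct1)
  have "shift \<tau> i \<noteq> {} \<and> shift \<tau> i \<subseteq> {1..n}" if i: "i \<in> {1..d}" for i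
  proof -
    have "\<tau> i \<noteq> {}"
      using st i unfolding stairs_def by blast
    moreover have "j + (i - 1) \<in> {1..n}" if "j \<in> \<tau> i" for j
    proof -
      have "j \<in> {1..N}"
        using stairs_sub[OF st i] that by blast
      then show ?thesis
        using i assms by auto
    qed
    ultimately show ?thesis
      unfolding shift_def by blast
  qed
  moreover have "set_less (shift \<tau> i) (shift \<tau> j)" if ij: "i \<in> {1..d}" "j \<in> {1..d}" "i < j" for i j
  proof -
    have "s + (i - 1) < t + (j - 1)" if "s \<in> \<tau> i" "t \<in> \<tau> j" for s t
      using stairs_le[OF st ij that] ij by auto
    then show ?thesis
      unfolding set_less_def shift_def by blast
  qed
  moreover have "v ` {1..d} \<in> E" if v: "\<forall>i\<in>{1..d}. v i \<in> shift \<tau> i" for v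
  proof -
    have "\<forall>i\<in>{1..d}. \<exists>j. j \<in> \<tau> i \<and> v i = j + (i - 1)"
      using v unfolding shift_def by blast
    then obtain w where w: "\<forall>i\<in>{1..d}. w i \<in> \<tau> i \<and> v i = w i + (i - 1)"
      by metis
    then have "(\<lambda>i. w i + (i - 1)) ` {1..d} \<in> E"
      using in_E unfolding stairs_in_def by blast
    moreover have "v ` {1..d} = (\<lambda>i. w i + (i - 1)) ` {1..d}"
      using w by (intro image_cong) auto
    ultimately show ?thesis by simp
  qed
  ultimately show "C \<in> X_graph n d E"
    unfolding X_graph_def C by blast
qed

subsection \<open>The staircase subdivision\<close>

lemma stairs_singletons:
  assumes "v \<in> {1..d} \<rightarrow> {1..N}" "mono_on {1..d} v"
  shows "stairs (\<lambda>i. {v i})"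
  unfolding stairs_def
proof (intro conjI ballI impI)
  fix i j s t assume "i \<in> {1..d}" "j \<in> {1..d}" "i < j" "s \<in> {v i}" "t \<in> {v j}"
  then show "s \<le> t"
    using mono_onD[OF assms(2)] by auto
qed (use assms(1) in auto)

text \<open>For families of singletons, \<open>cell_iff\<close> puts the support of the common point
  inside both \<open>{v i}\<close> and \<open>{w i}\<close>, and supports are nonempty.\<close>

lemma vertex_eq_imp:
  assumes "v \<in> {1..d} \<rightarrow> {1..N}" "mono_on {1..d} v" "w \<in> {1..d} \<rightarrow> {1..N}" "mono_on {1..d} w"
    and eq: "(\<Sum>k\<in>{1..d}. e (v k)) = (\<Sum>k\<in>{1..d}. e (w k))" and i: "i \<in> {1..d}"
  shows "v i = w i"
proof -
  let ?x = "\<Sum>k\<in>{1..d}. e (v k)"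
  have st: "stairs (\<lambda>i. {v i})" "stairs (\<lambda>i. {w i})"
    using stairs_singletons[OF assms(1,2)] stairs_singletons[OF assms(3,4)] .
  have "?x \<in> cell (\<lambda>i. {v i})"
    unfolding cell_singletons by simp
  then have *: "?x \<in> dilate" "supp ?x i \<subseteq> {v i}"
    using cell_iff[OF st(1)] i by blast+
  have "?x \<in> cell (\<lambda>i. {w i})"
    unfolding cell_singletons eq by simp
  then have "supp ?x i \<subseteq> {w i}"
    using cell_iff[OF st(2)] i by blast
  moreover have "supp ?x i \<noteq> {}"
    using stairs_supp[OF *(1)] i unfolding stairs_def by blast
  ultimately show ?thesis
    using *(2) by blast
qed

text \<open>A choice from an increasing family is an increasing index sequence, and by
  \<open>vertex_eq_imp\<close> no other one yields the same point; this makes the definite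
  description in \<open>vertex_label\<close> meaningful.\<close>

lemma vertex_label_stairs:
  assumes "stairs \<tau>" "\<forall>i\<in>{1..d}. v i \<in> \<tau> i" "N = n - d + 1"
  shows "vertex_label e d n (\<Sum>k\<in>{1..d}. e (v k)) = (\<lambda>k. v k + (k - 1)) ` {1..d}"
proof -
  have v: "v \<in> {1..d} \<rightarrow> {1..N}"
    using assms(2) stairs_sub[OF assms(1)] by blast
  have mono: "mono_on {1..d} v"
  proof (rule mono_onI)
    fix i j assume ij: "i \<in> {1..d}" "j \<in> {1..d}" "i \<le> j"
    show "v i \<le> v j"
    proof (cases "i = j")
      case False
      then have "i < j"
        using ij(3) by simp
      then show ?thesis
        using stairs_le[OF assms(1) ij(1,2)] assms(2) ij(1,2) by blast
    qed simp
  qed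
  show ?thesis
    unfolding vertex_label_def
  proof (rule the_equality)
    show "\<exists>i. i \<in> {1..d} \<rightarrow> {1..n - d + 1} \<and> mono_on {1..d} i \<and>
        (\<Sum>k\<in>{1..d}. e (v k)) = (\<Sum>k\<in>{1..d}. e (i k)) \<and>
        (\<lambda>k. v k + (k - 1)) ` {1..d} = (\<lambda>k. i k + (k - 1)) ` {1..d}"
      unfolding assms(3)[symmetric] using v mono by (intro exI[of _ v] conjI refl)
  next
    fix L
    assume "\<exists>i. i \<in> {1..d} \<rightarrow> {1..n - d + 1} \<and> mono_on {1..d} i \<and>
        (\<Sum>k\<in>{1..d}. e (v k)) = (\<Sum>k\<in>{1..d}. e (i k)) \<and>
        L = (\<lambda>k. i k + (k - 1)) ` {1..d}"
    then obtain w where w: "w \<in> {1..d} \<rightarrow> {1..N}" "mono_on {1..d} w"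
      "(\<Sum>k\<in>{1..d}. e (v k)) = (\<Sum>k\<in>{1..d}. e (w k))" "L = (\<lambda>k. w k + (k - 1)) ` {1..d}"
      unfolding assms(3)[symmetric] by (elim exE conjE)
    then show "L = (\<lambda>k. v k + (k - 1)) ` {1..d}"
      unfolding w(4) using vertex_eq_imp[OF v mono w(1-3)] by (intro image_cong refl) simp
  qed
qed

definition full_stairs :: "(nat \<Rightarrow> nat) \<Rightarrow> bool" where
  "full_stairs b \<longleftrightarrow> b 1 = 1 \<and> b (d + 1) = N \<and> (\<forall>i\<in>{1..d}. b i \<le> b (i + 1))"

lemma full_stairs_mono:
  assumes "full_stairs b" "1 \<le> i" "i \<le> j" "j \<le> d + 1"
  shows "b i \<le> b j"
  using assms(3,4)
proof (induction j rule: dec_induct)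
  case (step k)
  then have "b k \<le> b (k + 1)"
    using assms(1,2) unfolding full_stairs_def by auto
  then show ?case
    using step by simp
qed simp

lemma stairs_intervals:
  assumes "full_stairs b"
  shows "stairs (\<lambda>i. {b i..b (i + 1)})"
  unfolding stairs_def
proof (intro conjI ballI impI)
  fix i assume i: "i \<in> {1..d}"
  have b: "b 1 = 1" "b (d + 1) = N"
    using assms by (simp_all add: full_stairs_def)
  have "b 1 \<le> b i" "b i \<le> b (i + 1)" "b (i + 1) \<le> b (d + 1)"
    using i by (intro full_stairs_mono[OF assms]; simp)+
  then show "{b i..b (i + 1)} \<noteq> {}" "{b i..b (i + 1)} \<subseteq> {1..N}"
    using b by auto
next
  fix i j s t
  assume i: "i \<in> {1..d}" "j \<in> {1..d}" "i < j" and "s \<in> {b i..b (i + 1)}" "t \<in> {b j..b (j + 1)}"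
  moreover have "b (i + 1) \<le> b j"
    using i by (intro full_stairs_mono[OF assms]) auto
  ultimately show "s \<le> t" by auto
qed

text \<open>Makes every cell a face of a staircase cell: a family can be enlarged to intervals that
  share only their end points.\<close>

lemma stairs_extend:
  assumes "stairs \<tau>"
  obtains b where "full_stairs b" "\<And>i. i \<in> {1..d} \<Longrightarrow> \<tau> i \<subseteq> {b i..b (i + 1)}"
proof -
  \<comment> \<open>The corner between factors i - 1 and i is the largest element of
    \<open>\<tau> (i - 1)\<close>, which is at most every element of \<open>\<tau> i\<close>; the
    two ends are prescribed.\<close>
  define b where "b i = (if i = 1 then 1 else if i = d + 1 then N else Max (\<tau> (i - 1)))" for i
  have fin: "finite (\<tau> i)" if "i \<in> {1..d}" for i
    using stairs_sub[OF assms that] finite_subset by blast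
  have lower: "b i \<le> s" if i: "i \<in> {1..d}" and s: "s \<in> \<tau> i" for i s
  proof (cases "i = 1")
    case True
    then show ?thesis
      using stairs_sub[OF assms i] s by (auto simp: b_def)
  next
    case False
    then have i': "i - 1 \<in> {1..d}" "i - 1 < i"
      using i by auto
    have "\<tau> (i - 1) \<noteq> {}"
      using assms i'(1) unfolding stairs_def by blast
    then have "Max (\<tau> (i - 1)) \<in> \<tau> (i - 1)"
      using fin[OF i'(1)] by (intro Max_in)
    then have "Max (\<tau> (i - 1)) \<le> s"
      using stairs_le[OF assms i'(1) i i'(2)] s by blast
    then show ?thesis
      using False i by (simp add: b_def)
  qed
  have upper: "s \<le> b (i + 1)" if i: "i \<in> {1..d}" and s: "s \<in> \<tau> i" for i s
  proof (cases "i = d")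
    case True
    then show ?thesis
      using stairs_sub[OF assms i] s d_pos by (auto simp: b_def)
  next
    case False
    then show ?thesis
      using i s fin[OF i] by (simp add: b_def)
  qed
  have "b i \<le> b (i + 1)" if i: "i \<in> {1..d}" for i
  proof -
    obtain s where "s \<in> \<tau> i"
      using assms i unfolding stairs_def by blast
    then show ?thesis
      using lower[OF i] upper[OF i] le_trans by blast
  qed
  then have "full_stairs b"
    using d_pos by (simp add: full_stairs_def b_def)
  moreover have "\<tau> i \<subseteq> {b i..b (i + 1)}" if "i \<in> {1..d}" for i
    using lower[OF that] upper[OF that] by auto
  ultimately show thesis
    using that by blast
qed

lemma X_staircase_eq:
  assumes "N = n - d + 1"
  shows "X_staircase e d n = cell ` {\<tau>. stairs \<tau>}"
proof -
  have X: "X_staircase e d n =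
      {F. F \<noteq> {} \<and> (\<exists>b. full_stairs b \<and> F face_of cell (\<lambda>i. {b i..b (i + 1)}))}"
    unfolding X_staircase_def staircase_cell_def full_stairs_def cell_def assms[symmetric]
    by (simp only: conj_assoc)
  show ?thesis
    unfolding X
  proof (intro equalityI subsetI)
    fix F assume "F \<in> {F. F \<noteq> {} \<and> (\<exists>b. full_stairs b \<and> F face_of cell (\<lambda>i. {b i..b (i + 1)}))}"
    then obtain b where b: "F \<noteq> {}" "full_stairs b" "F face_of cell (\<lambda>i. {b i..b (i + 1)})"
      by blast
    obtain \<tau> where "\<And>i. i \<in> {1..d} \<Longrightarrow> \<tau> i \<subseteq> {b i..b (i + 1)}" "\<And>i. i \<in> {1..d} \<Longrightarrow> \<tau> i \<noteq> {}" "F = cell \<tau>"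
      using face_of_cell[OF stairs_intervals[OF b(2)] b(3,1)] by blast
    then show "F \<in> cell ` {\<tau>. stairs \<tau>}"
      using stairs_subfamily[OF stairs_intervals[OF b(2)]] by blast
  next
    fix F assume "F \<in> cell ` {\<tau>. stairs \<tau>}"
    then obtain \<tau> where \<tau>: "stairs \<tau>" "F = cell \<tau>"
      by blast
    obtain b where b: "full_stairs b" "\<And>i. i \<in> {1..d} \<Longrightarrow> \<tau> i \<subseteq> {b i..b (i + 1)}"
      using stairs_extend[OF \<tau>(1)] by blast
    have "\<tau> i \<noteq> {}" if "i \<in> {1..d}" for i
      using \<tau>(1) that unfolding stairs_def by blast
    then have "cell \<tau> face_of cell (\<lambda>i. {b i..b (i + 1)})"
      using b(2) by (intro subcell_face[OF stairs_intervals[OF b(1)]]) simp_all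
    then show "F \<in> {F. F \<noteq> {} \<and> (\<exists>b. full_stairs b \<and> F face_of cell (\<lambda>i. {b i..b (i + 1)}))}"
      using b(1) \<tau> cell_nonempty by blast
  qed
qed

text \<open>The extreme points of a cell are the sums of choices from its family, and their labels
  are the shifted choices.\<close>

lemma X_induced_eq:
  assumes "N = n - d + 1"
  shows "X_induced e d n E = cell ` {\<tau>. stairs_in E \<tau>}"
proof -
  have "(\<forall>x. x extreme_point_of cell \<tau> \<longrightarrow> vertex_label e d n x \<in> E) \<longleftrightarrow> stairs_in E \<tau>" if "stairs \<tau>" for \<tau>
  proof -
    have "(\<forall>x. x extreme_point_of cell \<tau> \<longrightarrow> vertex_label e d n x \<in> E) \<longleftrightarrow>
        (\<forall>v. (\<forall>i\<in>{1..d}. v i \<in> \<tau> i) \<longrightarrow> vertex_label e d n (\<Sum>i\<in>{1..d}. e (v i)) \<in> E)"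
      unfolding extreme_point_cell[OF that] by blast
    also have "\<dots> \<longleftrightarrow> (\<forall>v. (\<forall>i\<in>{1..d}. v i \<in> \<tau> i) \<longrightarrow> (\<lambda>i. v i + (i - 1)) ` {1..d} \<in> E)"
      using vertex_label_stairs[OF that _ assms] by metis
    finally show ?thesis
      using that unfolding stairs_in_def by simp
  qed
  moreover have "stairs \<tau>" if "stairs_in E \<tau>" for \<tau>
    using that unfolding stairs_in_def by (rule conjunct1)
  ultimately show ?thesis
    unfolding X_induced_def X_staircase_eq[OF assms] by blast
qed

text \<open>The Minkowski sum is the cell of the constant family \<open>{1..N}\<close>. That family
  need not satisfy \<open>stairs\<close>, so a point is first placed in the cell of its own
  support.\<close>

lemma dilated_simplex_eq:
  assumes "N = m + 1"
  shows "dilated_simplex e d m = dilate"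
proof -
  have "dilated_simplex e d m = cell (\<lambda>_. {1..N})"
    unfolding dilated_simplex_def std_simplex_def cell_def assms ..
  moreover have "x \<in> cell (\<lambda>_. {1..N})" if "x \<in> dilate" for x
  proof -
    have "x \<in> cell (supp x)"
      using that cell_iff[OF stairs_supp[OF that]] by blast
    then show ?thesis
      using cell_mono[of "supp x" "\<lambda>_. {1..N}"] supp_sub by blast
  qed
  ultimately show ?thesis
    using cell_full by blast
qed

lemma finite_cells: "finite (cell ` {\<tau>. stairs \<tau>})"
proof (rule finite_subset)
  show "cell ` {\<tau>. stairs \<tau>} \<subseteq> cell ` (\<Pi>\<^sub>E i\<in>{1..d}. Pow {1..N})"
  proof
    fix C assume "C \<in> cell ` {\<tau>. stairs \<tau>}"
    then obtain \<tau> where \<tau>: "stairs \<tau>" "C = cell \<tau>"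
      by blast
    \<comment> \<open>Only the values of a family on \<open>{1..d}\<close> enter its cell, which
      leaves finitely many families.\<close>
    have "C = cell (restrict \<tau> {1..d})"
      unfolding \<tau>(2) by (intro cell_cong) simp
    moreover have "restrict \<tau> {1..d} \<in> (\<Pi>\<^sub>E i\<in>{1..d}. Pow {1..N})"
      using stairs_sub[OF \<tau>(1)] by auto
    ultimately show "C \<in> cell ` (\<Pi>\<^sub>E i\<in>{1..d}. Pow {1..N})"
      by (rule image_eqI)
  qed
  show "finite (cell ` (\<Pi>\<^sub>E i\<in>{1..d}. Pow {1..N}))"
    by (intro finite_imageI finite_PiE) auto
qed

lemma polyhedral_subdivision_cells: "polyhedral_subdivision (cell ` {\<tau>. stairs \<tau>}) dilate"
  unfolding polyhedral_subdivision_def polyhedral_complex_def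
proof (intro conjI ballI allI impI)
  show "finite (cell ` {\<tau>. stairs \<tau>})"
    by (rule finite_cells)
  show "\<Union> (cell ` {\<tau>. stairs \<tau>}) = dilate"
  proof (intro equalityI subsetI)
    fix x assume "x \<in> dilate"
    then have "stairs (supp x)" "x \<in> cell (supp x)"
      using stairs_supp cell_iff by blast+
    then show "x \<in> \<Union> (cell ` {\<tau>. stairs \<tau>})"
      by blast
  qed (use cell_iff in blast)
next
  fix C assume "C \<in> cell ` {\<tau>. stairs \<tau>}"
  then obtain \<tau> where \<tau>: "stairs \<tau>" "C = cell \<tau>"
    by blast
  then show "polytope C" "C \<noteq> {}"
    using polytope_cell cell_nonempty by blast+
  show "F \<in> cell ` {\<tau>. stairs \<tau>}" if "F face_of C \<and> F \<noteq> {}" for F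
  proof -
    have F: "F face_of cell \<tau>" "F \<noteq> {}"
      using that \<tau>(2) by blast+
    obtain \<tau>' where "\<And>i. i \<in> {1..d} \<Longrightarrow> \<tau>' i \<subseteq> \<tau> i" "\<And>i. i \<in> {1..d} \<Longrightarrow> \<tau>' i \<noteq> {}" "F = cell \<tau>'"
      using face_of_cell[OF \<tau>(1) F] by blast
    then show ?thesis
      using stairs_subfamily[OF \<tau>(1)] by blast
  qed
  fix D assume "D \<in> cell ` {\<tau>. stairs \<tau>}"
  then obtain \<rho> where \<rho>: "stairs \<rho>" "D = cell \<rho>"
    by blast
  show "(C \<inter> D) face_of C"
    unfolding \<tau>(2) \<rho>(2) using \<tau>(1) \<rho>(1) by (rule cell_Int_face)
  show "(C \<inter> D) face_of D"
    unfolding \<tau>(2) \<rho>(2) Int_commute[of "cell \<tau>"] using \<rho>(1) \<tau>(1) by (rule cell_Int_face)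
qed


section \<open>Dimension of the staircase cells, and the mixed subdivision\<close>

lemma N_eq: "N = DIM('a)"
  using bij_betw_same_card[OF bij_e] by simp

lemma aff_dim_staircase:
  assumes "full_stairs b"
  shows "aff_dim (cell (\<lambda>i. {b i..b (i + 1)})) = int N - 1"
proof (rule antisym)
  let ?A = "cell (\<lambda>i. {b i..b (i + 1)})"
  have st: "stairs (\<lambda>i. {b i..b (i + 1)})"
    using assms by (rule stairs_intervals)
  \<comment> \<open>A normal vector of the hyperplane where the coordinates sum to d. The cell lies
    in it, whence the upper bound.\<close>
  define a where "a = (\<Sum>k\<in>{1..N}. e k)"
  have "1 \<in> {1..N}"
    using N_eq by (simp add: Suc_le_eq)
  have ae: "a \<bullet> e k = 1" if "k \<in> {1..N}" for k
  proof -
    have "a \<bullet> e k = (\<Sum>j\<in>{1..N}. if j = k then 1 else 0)"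
      unfolding a_def inner_sum_left using inner_e that by (intro sum.cong) auto
    then show ?thesis
      using that by simp
  qed
  have "a \<noteq> 0"
    using ae[OF \<open>1 \<in> {1..N}\<close>] by force
  have "a \<bullet> x = (\<Sum>k\<in>{1..N}. x \<bullet> e k)" for x
    unfolding a_def inner_sum_left by (simp add: inner_commute)
  then have "?A \<subseteq> {x. a \<bullet> x = real d}"
    using cell_iff[OF st] by (auto simp: dilate_def)
  then have "aff_dim ?A \<le> aff_dim {x. a \<bullet> x = real d}"
    by (rule aff_dim_subset)
  then show "aff_dim ?A \<le> int N - 1"
    using aff_dim_hyperplane[OF \<open>a \<noteq> 0\<close>] by (simp add: N_eq)
  \<comment> \<open>
    For the lower bound, the directions \<open>D\<close> of the cell contain enough edges \<open>e k - e (b i)\<close> to span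
    all differences of basis vectors.
  \<close>
  define p where "p = (\<Sum>i\<in>{1..d}. e (b i))"
  define D where "D = (\<lambda>x. x - p) ` ?A"
  have ble: "b i \<le> b (i + 1)" if "i \<in> {1..d}" for i
    using assms that unfolding full_stairs_def by blast
  have pA: "p \<in> ?A"
    unfolding p_def using ble by (intro vertex_in_cell) simp
  have edge: "e k - e (b i) \<in> D" if i: "i \<in> {1..d}" and k: "k \<in> {b i..b (i + 1)}" for i k
  proof -
    let ?q = "\<Sum>j\<in>{1..d}. e (if j = i then k else b j)"
    have "?q \<in> ?A"
      using k ble by (intro vertex_in_cell) auto
    moreover have "?q - p = (\<Sum>j\<in>{1..d}. if j = i then e k - e (b i) else 0)"
      unfolding p_def sum_subtractf[symmetric] by (intro sum.cong) auto
    then have "e k - e (b i) = ?q - p"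
      using i by simp
    ultimately show ?thesis
      unfolding D_def by (intro image_eqI)
  qed
  have unit_step: "e (j + 1) - e j \<in> span D" if j: "1 \<le> j" "j < N" for j
  proof -
    \<comment> \<open>The corners climb from 1 to \<open>N\<close>, so some interval from
      \<open>b i\<close> to \<open>b (i + 1)\<close> contains both j and j + 1. The unit step is
      then a difference of two edges starting at \<open>e (b i)\<close>.\<close>
    have "\<exists>i\<in>{1..d}. b i \<le> j \<and> j < b (i + 1)"
    proof (rule ccontr)
      assume none: "\<not> (\<exists>i\<in>{1..d}. b i \<le> j \<and> j < b (i + 1))"
      have "i \<le> d \<Longrightarrow> b (i + 1) \<le> j" for i
      proof (induction i)
        case 0
        then show ?case using assms j by (simp add: full_stairs_def)
      next
        case (Suc i)
        then have "b (Suc i) \<le> j" "Suc i \<in> {1..d}"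
          by simp_all
        then show ?case
          using none by (metis linorder_not_less)
      qed
      then have "N \<le> j"
        using assms unfolding full_stairs_def by (metis order_refl)
      then show False using j by simp
    qed
    then obtain i where i: "i \<in> {1..d}" "b i \<le> j" "j < b (i + 1)"
      by blast
    then have "(e (j + 1) - e (b i)) - (e j - e (b i)) \<in> span D"
      using edge[OF i(1)] by (intro span_diff span_base) auto
    then show ?thesis by simp
  qed
  \<comment> \<open>Starting from \<open>e 1\<close>, the unit steps reach every basis vector; so
    \<open>D\<close> falls short of spanning the space by at most one dimension.\<close>
  let ?D = "insert (e 1) D"
  have "1 \<le> j \<Longrightarrow> j \<le> N \<Longrightarrow> e j \<in> span ?D" for j
  proof (induction j rule: dec_induct)
    case base
    show ?case by (intro span_base) simp
  next
    case (step j)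
    have "e (j + 1) - e j \<in> span ?D"
      using unit_step[OF step(1)] step(2,4) span_mono[of D ?D] by auto
    moreover have "e j \<in> span ?D"
      using step by simp
    ultimately have "(e (j + 1) - e j) + e j \<in> span ?D"
      by (rule span_add)
    then show ?case by simp
  qed
  then have "Basis \<subseteq> span ?D"
    unfolding e_image[symmetric] by auto
  then have "N \<le> dim ?D"
    using dim_subset[of Basis "span ?D"] by (simp add: N_eq dim_eq_card_independent independent_Basis)
  also have "dim ?D \<le> dim D + 1"
    by (simp add: dim_insert)
  finally have "int N \<le> int (dim D) + 1" by simp
  moreover have "aff_dim ?A = int (dim D)"
    unfolding D_def using pA by (intro aff_dim_eq_dim_subtract hull_inc)
  ultimately show "int N - 1 \<le> aff_dim ?A" by simp
qed

lemma face_of_std_simplex: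
  assumes "N = m + 1" "A \<subseteq> {1..N}"
  shows "convex hull (e ` A) face_of std_simplex e m"
proof -
  have "\<not> affine_dependent (e ` {1..N})"
    unfolding e_image using independent_Basis affine_dependent_imp_dependent by blast
  then show ?thesis
    unfolding std_simplex_def assms(1)[symmetric]
    using face_of_convex_hull_affine_independent assms(2) by blast
qed

text \<open>By \<open>stairs_extend\<close> a maximal cell lies in a staircase cell and hence equals
  it; staircase cells are sums of faces and have the right dimension.\<close>

lemma mixed_subdivision_cells:
  assumes "N = m + 1"
  shows "mixed_subdivision e d m (cell ` {\<tau>. stairs \<tau>})"
  unfolding mixed_subdivision_def
proof (intro conjI allI impI)
  show "polyhedral_subdivision (cell ` {\<tau>. stairs \<tau>}) (dilated_simplex e d m)"
    unfolding dilated_simplex_eq[OF assms] by (rule polyhedral_subdivision_cells)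
next
  fix C assume C: "maximal_cell (cell ` {\<tau>. stairs \<tau>}) C"
  then obtain \<tau> where \<tau>: "stairs \<tau>" "C = cell \<tau>"
    unfolding maximal_cell_def by blast
  obtain b where b: "full_stairs b" "\<And>i. i \<in> {1..d} \<Longrightarrow> \<tau> i \<subseteq> {b i..b (i + 1)}"
    using stairs_extend[OF \<tau>(1)] by blast
  let ?B = "\<lambda>i. {b i..b (i + 1)}"
  have st: "stairs ?B"
    using b(1) by (rule stairs_intervals)
  have "C \<subseteq> cell ?B"
    unfolding \<tau>(2) using b(2) by (rule cell_mono)
  moreover have "cell ?B \<in> cell ` {\<tau>. stairs \<tau>}"
    using st by blast
  ultimately have CB: "cell ?B = C"
    using C unfolding maximal_cell_def by blast
  have "\<forall>i\<in>{1..d}. convex hull (e ` ?B i) face_of std_simplex e m"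
    using stairs_sub[OF st] by (intro ballI face_of_std_simplex[OF assms])
  moreover have "C = (\<Sum>i\<in>{1..d}. convex hull (e ` ?B i))"
    unfolding CB[symmetric] cell_def ..
  moreover have "aff_dim C = int m"
    using aff_dim_staircase[OF b(1)] unfolding CB by (simp add: assms)
  ultimately show "mixed_cell e d m C"
    unfolding mixed_cell_def by (intro conjI exI[of _ "\<lambda>i. convex hull (e ` ?B i)"])
qed

text \<open>Extreme points of a face are extreme points of the cell, so faces inherit the condition
  on labels.\<close>

lemma subcomplex_induced:
  assumes "N = n - d + 1"
  shows "subcomplex (X_induced e d n E) (cell ` {\<tau>. stairs \<tau>})"
  unfolding subcomplex_def
proof (intro conjI ballI allI impI)
  show "X_induced e d n E \<subseteq> cell ` {\<tau>. stairs \<tau>}"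
    unfolding X_induced_def X_staircase_eq[OF assms] by blast
  fix C F assume C: "C \<in> X_induced e d n E" and F: "F face_of C \<and> F \<noteq> {}"
  have "C \<in> cell ` {\<tau>. stairs \<tau>}"
    using C unfolding X_induced_def X_staircase_eq[OF assms] by blast
  then have "F \<in> cell ` {\<tau>. stairs \<tau>}"
    using F polyhedral_subdivision_cells
    unfolding polyhedral_subdivision_def polyhedral_complex_def by blast
  moreover have "x extreme_point_of C" if "x extreme_point_of F" for x
    using F that extreme_point_of_face by blast
  ultimately show "F \<in> X_induced e d n E"
    using C unfolding X_induced_def X_staircase_eq[OF assms] by blast
qed

end

theorem proposition5p5:
  fixes n d :: nat and E :: "nat set set" and e :: "nat \<Rightarrow> 'a::euclidean_space"
  assumes "1 \<le> d" and "d \<le> n"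
    and "d_graph n d E"
    and "bij_betw e {1..(n - d) + 1} (Basis :: 'a set)"
  shows "cell_complex_isomorphic (X_induced e d n E) (X_graph n d E) \<and>
    (\<exists>S K. mixed_subdivision e d (n - d) S \<and> subcomplex K S \<and>
           cell_complex_isomorphic (X_graph n d E) K)"
proof -
  interpret staircase e "n - d + 1" d
    using assms(1,4) by unfold_locales
  have stairs: "stairs \<tau>" if "\<tau> \<in> {\<tau>. stairs_in E \<tau>}" for \<tau>
    using that unfolding stairs_in_def by blast
  have "cell_complex_isomorphic (X_induced e d n E) (X_graph n d E)"
    unfolding X_induced_eq[OF refl] X_graph_eq[OF refl assms(2)]
    using stairs by (rule isomorphic_cells(1))
  moreover have "cell_complex_isomorphic (X_graph n d E) (X_induced e d n E)"
    unfolding X_induced_eq[OF refl] X_graph_eq[OF refl assms(2)]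
    using stairs by (rule isomorphic_cells(2))
  \<comment> \<open>The mixed subdivision is the complex of all cells, and its subcomplex is the
    induced one.\<close>
  ultimately show ?thesis
    using mixed_subdivision_cells[OF refl] subcomplex_induced[OF refl] by blast
qed

end
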